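(* Let $M\subset\mathbb C^{n+1}$ and $M'\subset\mathbb C^{n'+1}$ be connected real-analytic hypersurfaces and $U$ an open neighborhood of $M$ in $\mathbb C^{n+1}$. Assume that $M$ is holomorphically nondegenerate. If $H\colon U\to\mathbb C^{n'+1}$ is a holomorphic mapping such that $H(M)\subset M'$ and the rank of $H$ is $\le n$ at every $p\in M$, then there is an open subset $V\subset U$ with $M\subset V$ and $H(V)\subset M'$.
   Context: Hypersurface means real hypersurface. The rank of $H$ at $p$ is the complex rank of its holomorphic Jacobian matrix at $p$. A connected real-analytic hypersurface $M\subset \mathbb C^{n+1}$ is holomorphically nondegenerate if there is no point of $M$ at which there is a germ of a nontrivial (not identically zero) holomorphic $(1,0)$-vector field $\sum_j a_j(Z)\,\partial/\partial Z_j$ ($a_j$ holomorphic) tangent to $M$. *)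

theory Defs
  imports "HOL-Analysis.Analysis"
begin

(* Real-analyticity: around every point of the open set S, f is the sum of a convergent power
   series in the real coordinates (x - p) \<bullet> b, b \<in> Basis.  Multi-indices are the
   functions Basis -> nat, made extensional off Basis so that each is counted once. On
   complex ^ 'n the set Basis consists of the real coordinate directions axis j 1 and axis j i. *)
definition real_analytic_on :: "('a::euclidean_space \<Rightarrow> real) \<Rightarrow> 'a set \<Rightarrow> bool" where
  "real_analytic_on f S \<longleftrightarrow> open S \<and>
     (\<forall>p\<in>S. \<exists>r>0. \<exists>c :: ('a \<Rightarrow> nat) \<Rightarrow> real. \<forall>x\<in>ball p r.
        ((\<lambda>\<alpha>. c \<alpha> * (\<Prod>b\<in>Basis. ((x - p) \<bullet> b) ^ \<alpha> b)) has_sum f x)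
          (Basis \<rightarrow>\<^sub>E UNIV))"

(* Holomorphic maps in several variables: the real Frechet derivative exists and is
   complex linear at every point of the open set S. *)
definition holomorphic_map_on ::
    "(complex ^ 'n \<Rightarrow> complex ^ 'm) \<Rightarrow> (complex ^ 'n) set \<Rightarrow> bool" where
  "holomorphic_map_on f S \<longleftrightarrow> open S \<and>
     (\<forall>z\<in>S. \<exists>A :: complex ^ 'n ^ 'm. (f has_derivative (\<lambda>v. A *v v)) (at z))"

definition holomorphic_jacobian ::
    "(complex ^ 'n \<Rightarrow> complex ^ 'm) \<Rightarrow> complex ^ 'n \<Rightarrow> complex ^ 'n ^ 'm" where
  "holomorphic_jacobian f z = (\<chi> i j. deriv (\<lambda>t. f (z + axis j t) $ i) 0)"

(* Wirtinger derivative: d/dZ_j = (d/dx_j - i d/dy_j) / 2 for Z_j = x_j + i y_j. *)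
definition dZ :: "'n \<Rightarrow> (complex ^ 'n \<Rightarrow> real) \<Rightarrow> complex ^ 'n \<Rightarrow> complex" where
  "dZ j \<rho> z =
     (complex_of_real (frechet_derivative \<rho> (at z) (axis j 1))
      - \<i> * complex_of_real (frechet_derivative \<rho> (at z) (axis j \<i>))) / 2"

definition local_defining_function ::
    "(complex ^ 'n) set \<Rightarrow> (complex ^ 'n) set \<Rightarrow> (complex ^ 'n \<Rightarrow> real) \<Rightarrow> bool" where
  "local_defining_function M W \<rho> \<longleftrightarrow>
     real_analytic_on \<rho> W \<and>
     (\<forall>z\<in>W. frechet_derivative \<rho> (at z) \<noteq> (\<lambda>v. 0)) \<and>
     M \<inter> W = {z \<in> W. \<rho> z = 0}"

(* Embedded real hypersurfaces; M need not be closed in the ambient space. *)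
definition real_analytic_hypersurface :: "(complex ^ 'n) set \<Rightarrow> bool" where
  "real_analytic_hypersurface M \<longleftrightarrow>
     (\<forall>p\<in>M. \<exists>W \<rho>. p \<in> W \<and> local_defining_function M W \<rho>)"

(* The map a stands for the (1,0)-vector field X = (\<Sum>j. a_j(Z) d/dZ_j).  It is tangent to M on W
   if X \<rho> = 0 along M for a local defining function \<rho>; near M any two such functions differ
   by a nonvanishing factor, so the choice of \<rho> does not matter. *)
definition tangent_holomorphic_field ::
    "(complex ^ 'n) set \<Rightarrow> (complex ^ 'n) set \<Rightarrow> (complex ^ 'n \<Rightarrow> complex ^ 'n) \<Rightarrow> bool" where
  "tangent_holomorphic_field M W a \<longleftrightarrow>
     holomorphic_map_on a W \<and>
     (\<exists>\<rho>. local_defining_function M W \<rho> \<and>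
          (\<forall>z\<in>M \<inter> W. (\<Sum>j\<in>UNIV. a z $ j * dZ j \<rho> z) = 0))"

(* The germ of a at p is nontrivial iff a does not vanish identically near p.  W may be
   shrunk freely, so it is harmless to take a defined on the domain of a defining function. *)
definition holomorphically_nondegenerate :: "(complex ^ 'n) set \<Rightarrow> bool" where
  "holomorphically_nondegenerate M \<longleftrightarrow>
     \<not> (\<exists>p\<in>M. \<exists>W a. p \<in> W \<and> tangent_holomorphic_field M W a \<and>
          \<not> (\<forall>\<^sub>F z in nhds p. a z = 0))"

end

theory Submission
  imports Defs "HOL-Complex_Analysis.Complex_Analysis"
begin

text \<open>Near \<open>p \<in> M\<close> the real-analytic function \<open>\<phi> = \<rho>' \<circ> H\<close>, with \<open>\<rho>'\<close> defining \<open>M'\<close>, vanishes on \<open>M\<close>;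
  it must vanish identically. At a point \<open>q \<in> M\<close> close to \<open>p\<close> where the rank of \<open>dH\<close> is maximal
  among points of \<open>M\<close>, there is a nowhere zero holomorphic field \<open>a\<close> near \<open>q\<close> with \<open>dH(a) = 0\<close>, first along \<open>M\<close> and then,
  as \<open>M\<close> is a uniqueness set for holomorphic functions, on a neighbourhood of \<open>q\<close>. By holomorphic
  nondegeneracy \<open>a\<close> is not tangent to \<open>M\<close> at some \<open>q' \<in> M\<close> near \<open>q\<close>. Since \<open>\<phi>\<close> is constant along \<open>a\<close> and
  vanishes on \<open>M\<close>, it vanishes near \<open>q'\<close>, hence near \<open>p\<close> by the identity theorem.\<close>

text \<open>The rank bound is assumed on \<open>M\<close> only; a priori the rank may be larger off
  \<open>M\<close>, so the kernels of \<open>dH\<close> need not form a bundle on a neighbourhood of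
  \<open>q\<close>. The field \<open>a\<close> is therefore obtained by solving a linear system with
  holomorphic coefficients on a full neighbourhood, with \<open>dH(a) = 0\<close> known at points of
  \<open>M\<close> alone until uniqueness spreads it. Tangency is a complex condition, transport a
  real one: if \<open>a\<close> is not tangent at \<open>q'\<close>, one of the real directions
  \<open>a\<close>, \<open>i a\<close> is transversal to \<open>M\<close> there, and complex
  linearity of \<open>dH\<close> makes \<phi> constant along both. The field is not integrated: a
  maximum principle carries the vanishing of \<phi> off \<open>M\<close>. Nor is \<phi> expanded as
  a composite power series: the series of \<rho>' is evaluated at holomorphic extensions of the real
  coordinates of \<open>H\<close> along complex lines, which gives an identity theorem on one ball
  about \<open>p\<close>, fixed before \<open>q\<close> and \<open>q'\<close> are chosen.\<close>

no_notation fps_nth (infixl "$" 75)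

section \<open>Linear algebra over a field\<close>

text \<open>A basis of \<open>S\<close> is sent to a spanning set of the image; the dimension bound
  leaves no room for it to collapse or become dependent.\<close>

lemma inj_on_subspace_if_dim_image_ge:
  fixes f :: "'a::field ^ 'm \<Rightarrow> 'a ^ 'n"
  assumes lin: "Vector_Spaces.linear (*s) (*s) f" and S: "vec.subspace S"
    and dim: "vec.dim S \<le> vec.dim (f ` S)"
  shows "inj_on f S"
proof -
  obtain B where B: "B \<subseteq> S" "vec.independent B" "S \<subseteq> vec.span B" "card B = vec.dim S"
    using vec.basis_exists[of S] by metis
  have sp: "vec.span B = S"
    using B S vec.span_subspace by blast
  have fin: "finite B" using B(2) vec.finiteI_independent by blast
  have fS: "f ` S = vec.span (f ` B)"
    using vec.linear_span_image[OF lin] sp by metis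
  have "card B \<le> vec.dim (f ` B)"
    using dim B(4) fS by simp
  moreover have "vec.dim (f ` B) \<le> card (f ` B)" "card (f ` B) \<le> card B"
    using fin by (auto intro: vec.dim_le_card' card_image_le)
  ultimately have c: "card (f ` B) = card B" "vec.dim (f ` B) = card (f ` B)" by auto
  have inj: "inj_on f B" using c(1) fin by (simp add: eq_card_imp_inj_on)
  have "vec.independent (f ` B)"
    using c(2) fin vec.card_le_dim_spanning[of "f ` B" "vec.span (f ` B)"]
    by (simp add: vec.span_base subsetI)
  then show ?thesis
    using vec.linear_inj_on_span_independent_image[OF lin _ inj] sp by simp
qed

text \<open>\<open>rank\<close> is by definition the row rank. Expanding the rows in a basis
  \<open>B\<close> of the row space factors \<open>A\<close> through dimension
  \<open>card B\<close>: the range is spanned by the \<open>card B\<close> columns of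
  coefficients.\<close>

lemma dim_range_le_rank:
  fixes A :: "'a::field ^ 'n ^ 'm"
  shows "vec.dim (range ((*v) A)) \<le> rank A"
proof -
  obtain B where B: "B \<subseteq> rows A" "vec.independent B" "rows A \<subseteq> vec.span B" "card B = vec.dim (rows A)"
    using vec.basis_exists[of "rows A"] by metis
  have fin: "finite B" using B(2) vec.finiteI_independent by blast
  have "\<forall>i. \<exists>c. A $ i = (\<Sum>b\<in>B. c b *s b)"
  proof
    fix i
    have "row i A \<in> vec.span B" using B(3) by (auto simp: rows_def)
    then have "A $ i \<in> vec.span B" by (simp add: row_def)
    then show "\<exists>c. A $ i = (\<Sum>b\<in>B. c b *s b)"
      using vec.span_finite[OF fin] by auto
  qed
  then obtain c where c: "\<And>i. A $ i = (\<Sum>b\<in>B. c i b *s b)" by metis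
  have "A *v x = (\<Sum>b\<in>B. (\<Sum>j\<in>UNIV. b $ j * x $ j) *s (\<chi> i. c i b))" for x
  proof -
    have "(A *v x) $ i = (\<Sum>b\<in>B. (\<Sum>j\<in>UNIV. b $ j * x $ j) *s (\<chi> i. c i b)) $ i" for i
    proof -
      have "(A *v x) $ i = (\<Sum>j\<in>UNIV. (\<Sum>b\<in>B. c i b * b $ j) * x $ j)"
        by (simp add: matrix_vector_mult_def c[of i])
      also have "\<dots> = (\<Sum>b\<in>B. (\<Sum>j\<in>UNIV. b $ j * x $ j) * c i b)"
        unfolding sum_distrib_right by (subst sum.swap) (simp add: mult_ac)
      finally show ?thesis by simp
    qed
    then show ?thesis by (simp add: vec_eq_iff)
  qed
  then have "range ((*v) A) \<subseteq> vec.span ((\<lambda>b. (\<chi> i. c i b)) ` B)"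
    by (auto simp: image_subset_iff vec.span_base intro!: vec.span_sum vec.span_scale)
  then have "vec.dim (range ((*v) A)) \<le> card ((\<lambda>b. (\<chi> i. c i b)) ` B)"
    using fin by (intro vec.dim_le_card) auto
  also have "\<dots> \<le> card B" using fin by (rule card_image_le)
  finally show ?thesis using B(4) by (simp add: row_rank_def_gen)
qed

lemma exists_kernel_vector:
  fixes A :: "'a::field ^ 'n ^ 'm"
  assumes "rank A < CARD('n)"
  shows "\<exists>v. v \<noteq> 0 \<and> A *v v = 0"
proof (rule ccontr)
  assume "\<not> ?thesis"
  then have "inj ((*v) A)"
    by (metis (no_types, lifting) eq_iff_diff_eq_0 injI matrix_vector_mult_diff_distrib)
  then have "inj_on ((*v) A) (vec.span UNIV)" by simp
  then have "vec.dim (range ((*v) A)) = vec.dim (UNIV :: ('a ^ 'n) set)"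
    by (intro vec.dim_image_eq[OF matrix_vector_mul_linear_gen])
  then show False using dim_range_le_rank[of A] assms
    by (simp add: vec_dim_card del: vec.dim_UNIV)
qed

text \<open>\<open>E\<close> is the matrix of a linear section of \<open>A\<close> over its range;
  it replaces the inverse of a singular or non-square matrix.\<close>

lemma exists_generalized_inverse:
  fixes A :: "'a::field ^ 'n ^ 'm"
  shows "\<exists>E. A ** E ** A = A"
proof -
  obtain g where g: "Vector_Spaces.linear (*s) (*s) g" "\<forall>v\<in>range ((*v) A). A *v g v = v"
    using vec.linear_exists_right_inverse_on[OF matrix_vector_mul_linear_gen[of A] vec.subspace_UNIV] by blast
  have "(A ** matrix g ** A) *v x = A *v x" for x
    using g by (simp add: matrix_vector_mul_assoc[symmetric] matrix_works)
  then show ?thesis by (auto simp: matrix_eq)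
qed

text \<open>Kernel vectors of \<open>A0\<close> are carried to kernel vectors of a nearby \<open>A\<close> by a map depending rationally
  on \<open>A\<close>. The identity \<open>A0 T = A0 E A\<close> for the perturbed identity \<open>T\<close> makes \<open>A0 E\<close> injective on the range
  of \<open>A\<close>.\<close>

lemma kernel_perturbation:
  fixes A A0 :: "'a::field ^ 'n ^ 'm"
  assumes E: "A0 ** E ** A0 = A0"
    and inv: "det (mat 1 + E ** (A - A0)) \<noteq> 0"
    and rank: "vec.dim (range ((*v) A)) \<le> vec.dim (range ((*v) A0))"
    and v: "A0 *v v = 0" and x: "(mat 1 + E ** (A - A0)) *v x = v"
  shows "A *v x = 0"
proof -
  let ?T = "mat 1 + E ** (A - A0)"
  have comm: "A0 ** ?T = A0 ** E ** A"
  proof -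
    have E': "A0 *v (E *v (A0 *v y)) = A0 *v y" for y
      using E by (metis matrix_vector_mul_assoc)
    have "(A0 ** ?T) *v y = (A0 ** E ** A) *v y" for y
      by (simp add: matrix_vector_mul_assoc[symmetric] algebra_simps E')
    then show ?thesis by (simp add: matrix_eq)
  qed
  have "surj ((*v) ?T)"
    using inv invertible_det_nz[of ?T] matrix_right_invertible_surjective[of ?T]
    unfolding invertible_def by blast
  then have "range ((*v) A0) = (*v) (A0 ** E) ` range ((*v) A)"
  proof -
    assume s: "surj ((*v) ?T)"
    have "range ((*v) A0) = (*v) A0 ` range ((*v) ?T)" using s by simp
    also have "\<dots> = range ((*v) (A0 ** ?T))" by (auto simp: image_image matrix_vector_mul_assoc)
    also have "\<dots> = (*v) (A0 ** E) ` range ((*v) A)"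
      unfolding comm by (auto simp: image_image matrix_vector_mul_assoc matrix_mul_assoc)
    finally show ?thesis .
  qed
  \<comment> \<open>\<open>A0 ** E\<close> carries the range of \<open>A\<close> onto that of
    \<open>A0\<close>, which by \<open>rank\<close> is no smaller, so nothing nonzero is lost. It
    sends \<open>A *v x\<close> to \<open>A0 *v v = 0\<close>.\<close>
  then have inj: "inj_on ((*v) (A0 ** E)) (range ((*v) A))"
    using rank
    by (intro inj_on_subspace_if_dim_image_ge matrix_vector_mul_linear_gen
        vec.linear_subspace_image[OF matrix_vector_mul_linear_gen vec.subspace_UNIV]) auto
  have "(A0 ** E) *v (A *v x) = (A0 ** E) *v (A *v 0)"
    using v x comm by (metis matrix_vector_mul_assoc matrix_vector_mult_0_right)
  then show ?thesis
    using inj_onD[OF inj] by (metis matrix_vector_mult_0_right rangeI)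
qed

section \<open>Complex differentiability in several variables\<close>

text \<open>Pointwise, scalar-valued counterpart of \<open>holomorphic_map_on\<close>. Real
  linearity of \<open>L\<close> comes with \<open>has_derivative\<close>, so complex homogeneity is
  all that must be added.\<close>

definition complex_differentiable_at :: "(complex ^ 'k \<Rightarrow> complex) \<Rightarrow> complex ^ 'k \<Rightarrow> bool" where
  "complex_differentiable_at f z \<longleftrightarrow>
     (\<exists>L. (f has_derivative L) (at z) \<and> (\<forall>c v. L (c *s v) = c * L v))"

lemma complex_differentiable_const: "complex_differentiable_at (\<lambda>z. c) z"
  unfolding complex_differentiable_at_def
  by (rule exI[of _ "\<lambda>v. 0"]) simp

lemma complex_differentiable_add:
  assumes "complex_differentiable_at f z" "complex_differentiable_at g z"
  shows "complex_differentiable_at (\<lambda>x. f x + g x) z"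
proof -
  from assms obtain L1 L2 where L: "(f has_derivative L1) (at z)" "\<forall>c v. L1 (c *s v) = c * L1 v"
    "(g has_derivative L2) (at z)" "\<forall>c v. L2 (c *s v) = c * L2 v"
    unfolding complex_differentiable_at_def by metis
  show ?thesis unfolding complex_differentiable_at_def
    using has_derivative_add[OF L(1,3)] L(2,4)
    by (intro exI[of _ "\<lambda>v. L1 v + L2 v"]) (simp add: distrib_left)
qed

lemma complex_differentiable_mult:
  assumes "complex_differentiable_at f z" "complex_differentiable_at g z"
  shows "complex_differentiable_at (\<lambda>x. f x * g x) z"
proof -
  from assms obtain L1 L2 where L: "(f has_derivative L1) (at z)" "\<forall>c v. L1 (c *s v) = c * L1 v"
    "(g has_derivative L2) (at z)" "\<forall>c v. L2 (c *s v) = c * L2 v"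
    unfolding complex_differentiable_at_def by metis
  show ?thesis unfolding complex_differentiable_at_def
    using has_derivative_mult[OF L(1,3)] L(2,4)
    by (intro exI[of _ "\<lambda>v. f z * L2 v + L1 v * g z"]) (simp add: distrib_left mult_ac)
qed

lemma complex_differentiable_inverse:
  assumes "complex_differentiable_at f z" "f z \<noteq> 0"
  shows "complex_differentiable_at (\<lambda>x. inverse (f x)) z"
proof -
  from assms obtain L where L: "(f has_derivative L) (at z)" "\<forall>c v. L (c *s v) = c * L v"
    unfolding complex_differentiable_at_def by metis
  show ?thesis unfolding complex_differentiable_at_def
    using Deriv.has_derivative_inverse[OF assms(2) L(1)] L(2)
    by (intro exI[of _ "\<lambda>v. - (inverse (f z) * L v * inverse (f z))"]) simp
qed

lemma complex_differentiable_sum: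
  assumes "\<And>i. i \<in> A \<Longrightarrow> complex_differentiable_at (f i) z"
  shows "complex_differentiable_at (\<lambda>x. \<Sum>i\<in>A. f i x) z"
  using assms by (induction A rule: infinite_finite_induct)
    (simp_all add: complex_differentiable_const complex_differentiable_add)

lemma complex_differentiable_prod:
  assumes "\<And>i. i \<in> A \<Longrightarrow> complex_differentiable_at (f i) z"
  shows "complex_differentiable_at (\<lambda>x. \<Prod>i\<in>A. f i x) z"
  using assms by (induction A rule: infinite_finite_induct)
    (simp_all add: complex_differentiable_const complex_differentiable_mult)

text \<open>Feeds Cramer's rule: solutions of linear systems with holomorphic coefficients are
  holomorphic.\<close>

lemma complex_differentiable_det:
  fixes A :: "complex ^ 'k \<Rightarrow> complex ^ 'n ^ 'n"
  assumes "\<And>i j. complex_differentiable_at (\<lambda>x. A x $ i $ j) z"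
  shows "complex_differentiable_at (\<lambda>x. det (A x)) z"
  unfolding det_def
  by (intro complex_differentiable_sum complex_differentiable_mult complex_differentiable_prod
      complex_differentiable_const assms)

lemma complex_differentiable_imp_isCont:
  "complex_differentiable_at f z \<Longrightarrow> isCont f z"
  unfolding complex_differentiable_at_def using has_derivative_continuous by blast

lemma has_derivative_vec_componentwise:
  fixes f :: "'a::real_normed_vector \<Rightarrow> complex ^ 'n"
  assumes "\<And>i. ((\<lambda>x. f x $ i) has_derivative (\<lambda>h. f' h $ i)) (at z)"
  shows "(f has_derivative f') (at z)"
proof (rule has_derivative_componentwise_within[THEN iffD2], rule ballI)
  fix b :: "complex ^ 'n" assume "b \<in> Basis"
  then obtain i c where b: "b = axis i c" by (auto simp: Basis_vec_def)
  show "((\<lambda>x. f x \<bullet> b) has_derivative (\<lambda>x. f' x \<bullet> b)) (at z)"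
    unfolding b inner_axis by (intro has_derivative_inner_left assms)
qed

lemma complex_linear_expand:
  fixes L :: "complex ^ 'k \<Rightarrow> complex"
  assumes "linear L" "\<forall>c v. L (c *s v) = c * L v"
  shows "L v = (\<Sum>j\<in>UNIV. L (axis j 1) * v $ j)"
proof -
  have "L v = L (\<Sum>j\<in>UNIV. v $ j *s axis j 1)" by (simp add: basis_expansion)
  also have "\<dots> = (\<Sum>j\<in>UNIV. L (v $ j *s axis j 1))" by (rule linear_sum[OF assms(1)])
  finally show ?thesis using assms(2) by (simp add: mult.commute)
qed

lemma holomorphic_map_onI:
  assumes "open S" "\<And>z i. z \<in> S \<Longrightarrow> complex_differentiable_at (\<lambda>x. f x $ i) z"
  shows "holomorphic_map_on f S"
  unfolding holomorphic_map_on_def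
proof (intro conjI ballI assms(1))
  fix z assume "z \<in> S"
  then obtain L where L: "\<And>i. ((\<lambda>x. f x $ i) has_derivative L i) (at z)" "\<And>i. \<forall>c v. L i (c *s v) = c * L i v"
    using assms(2) unfolding complex_differentiable_at_def by metis
  have "(f has_derivative (\<lambda>v. (\<chi> i j. L i (axis j 1)) *v v)) (at z)"
  proof (rule has_derivative_vec_componentwise)
    fix i
    have "L i v = ((\<chi> i j. L i (axis j 1)) *v v) $ i" for v
      by (subst complex_linear_expand[OF has_derivative_linear[OF L(1)] L(2)])
        (simp add: matrix_vector_mult_def)
    then show "((\<lambda>x. f x $ i) has_derivative (\<lambda>h. ((\<chi> i j. L i (axis j 1)) *v h) $ i)) (at z)"
      using L(1)[of i] by (metis (no_types, lifting) ext)
  qed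
  then show "\<exists>A. (f has_derivative (*v) A) (at z)" by blast
qed

lemma has_derivative_vec_nth:
  fixes f :: "'a::real_normed_vector \<Rightarrow> complex ^ 'n"
  assumes "(f has_derivative f') F"
  shows "((\<lambda>x. f x $ i) has_derivative (\<lambda>h. f' h $ i)) F"
  by (rule bounded_linear.has_derivative[OF bounded_linear_vec_nth assms])

lemma holomorphic_map_on_component:
  assumes "holomorphic_map_on f S" "z \<in> S"
  shows "complex_differentiable_at (\<lambda>x. f x $ i) z"
proof -
  obtain A where "(f has_derivative (*v) A) (at z)" using assms unfolding holomorphic_map_on_def by blast
  then have "((\<lambda>x. f x $ i) has_derivative (\<lambda>h. (A *v h) $ i)) (at z)" by (rule has_derivative_vec_nth)
  moreover have "(A *v (c *s v)) $ i = c * (A *v v) $ i" for c v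
    by (simp add: vector_scalar_commute)
  ultimately show ?thesis unfolding complex_differentiable_at_def by blast
qed

section \<open>Restriction to complex lines, and holomorphy of derivatives by Cauchy's
  formula\<close>

lemma norm_vector_scalar_mult: "norm (c *s w) = norm c * norm w"
  for w :: "complex ^ 'n"
  by (simp add: norm_vec_def norm_mult L2_set_right_distrib)

lemma bounded_linear_vector_scalar: "bounded_linear (\<lambda>t::complex. t *s w)"
  by (intro linear_conv_bounded_linear[THEN iffD1] linearI) (auto simp: vec_eq_iff algebra_simps)

lemmas continuous_on_vector_scalar = bounded_linear.continuous_on[OF bounded_linear_vector_scalar]

lemma has_derivative_complex_line:
  fixes f :: "complex ^ 'k \<Rightarrow> complex"
  assumes "(f has_derivative L) (at (z + t *s w))" "\<forall>c v. L (c *s v) = c * L v"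
  shows "((\<lambda>t. f (z + t *s w)) has_field_derivative L w) (at t)"
proof -
  have "((\<lambda>t. z + t *s w) has_derivative (\<lambda>h. h *s w)) (at t)"
    using bounded_linear_imp_has_derivative[OF bounded_linear_vector_scalar[of w]] by (auto intro!: derivative_eq_intros)
  from has_derivative_compose[OF this assms(1)] assms(2) show ?thesis
    by (simp add: has_field_derivative_def mult_commute_abs)
qed

lemma holomorphic_jacobian_works:
  assumes "holomorphic_map_on f S" "z \<in> S"
  shows "(f has_derivative (\<lambda>v. holomorphic_jacobian f z *v v)) (at z)"
proof -
  obtain A where A: "(f has_derivative (*v) A) (at z)" using assms unfolding holomorphic_map_on_def by blast
  have "holomorphic_jacobian f z $ i $ j = A $ i $ j" for i j
  proof -
    have *: "((\<lambda>x. f x $ i) has_derivative (\<lambda>h. (A *v h) $ i)) (at (z + 0 *s axis j 1))"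
      using has_derivative_vec_nth[OF A] by simp
    have "((\<lambda>t. f (z + t *s axis j 1) $ i) has_field_derivative (A *v axis j 1) $ i) (at 0)"
      by (rule has_derivative_complex_line[OF *]) (simp add: vector_scalar_commute)
    moreover have "(t *s axis j 1) = (axis j t :: complex ^ 'a)" for t
      by (simp add: vec_eq_iff axis_def)
    moreover have "(A *v axis j 1) $ i = A $ i $ j"
      by (simp add: matrix_vector_mult_def axis_def if_distrib cong: if_cong)
    ultimately show ?thesis by (simp add: holomorphic_jacobian_def DERIV_imp_deriv)
  qed
  then have "holomorphic_jacobian f z = A" by (simp add: vec_eq_iff)
  with A show ?thesis by simp
qed

text \<open>Cauchy's formula on a circle in the complex line through \<open>z\<close> in direction
  \<open>w\<close>. Contour \<open>c\<close> and kernel \<open>k\<close> do not depend on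
  \<open>z\<close>, so the derivative becomes a parameter integral over values of \<open>f\<close>,
  and regularity of \<open>f\<close> passes to \<open>f'\<close>. Convexity of \<open>U\<close>
  serves differentiation under the integral.\<close>

lemma directional_derivative_Cauchy:
  fixes f :: "complex ^ 'k \<Rightarrow> complex"
  assumes "open S" and z0: "z0 \<in> S"
    and der: "\<And>z. z \<in> S \<Longrightarrow> (f has_derivative f' z) (at z)"
    and lin: "\<And>z c v. z \<in> S \<Longrightarrow> f' z (c *s v) = c * f' z v"
  obtains U and c k :: "real \<Rightarrow> complex" where "open U" "convex U" "z0 \<in> U" "U \<subseteq> S"
    "continuous_on {0..1} c" "continuous_on {0..1} k"
    "\<And>z t. z \<in> U \<Longrightarrow> t \<in> {0..1} \<Longrightarrow> z + c t *s w \<in> S"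
    "\<And>z. z \<in> U \<Longrightarrow> f' z w = integral {0..1} (\<lambda>t. f (z + c t *s w) * k t)"
proof -
  obtain e where e: "e > 0" "ball z0 e \<subseteq> S" using assms(1) z0 openE by blast
  \<comment> \<open>Displacements on the circle have norm \<open>r * norm w < e / 2\<close> and so
    lead from the half ball into \<open>ball z0 e\<close>; the \<open>+ 1\<close> covers
    \<open>w = 0\<close>.\<close>
  define r where "r = e / (2 * (norm w + 1))"
  have r: "r > 0" using e by (simp add: r_def add_nonneg_pos)
  have rw: "r * norm w < e / 2"
  proof -
    have "norm w / (norm w + 1) < 1" by (simp add: add_nonneg_pos divide_less_eq)
    then have "(e/2) * (norm w / (norm w + 1)) < (e/2) * 1" using e by (intro mult_strict_left_mono) auto
    then show ?thesis by (simp add: r_def field_simps)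
  qed
  have inS: "z + \<zeta> *s w \<in> S" if "z \<in> ball z0 (e/2)" "norm \<zeta> \<le> r" for z \<zeta>
  proof -
    have "norm (\<zeta> *s w) \<le> r * norm w"
      using that by (simp add: norm_vector_scalar_mult mult_right_mono)
    moreover have "dist z0 (z + \<zeta> *s w) \<le> dist z0 z + norm (\<zeta> *s w)"
      by (metis add_diff_cancel_left' dist_commute dist_norm dist_triangle)
    ultimately have "dist z0 (z + \<zeta> *s w) < e" using rw that(1) by simp
    then show ?thesis using e by auto
  qed
  define c where "c = circlepath (0::complex) r"
  \<comment> \<open>Cauchy kernel of a first derivative times the speed of the circle.\<close>
  define k where "k t = vector_derivative c (at t) / ((c t)\<^sup>2 * (2 * pi * \<i>))" for t
  have c_norm: "norm (c t) = r" for t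
    using r by (simp add: c_def circlepath norm_mult)
  have contc: "continuous_on {0..1} c"
    by (auto simp: c_def circlepath intro!: continuous_intros)
  have contk: "continuous_on {0..1} k"
  proof -
    have "c t \<noteq> 0" for t using c_norm[of t] r by auto
    moreover have "continuous_on {0..1} (\<lambda>t. vector_derivative c (at t))"
      by (simp add: c_def vector_derivative_circlepath) (intro continuous_intros)
    ultimately show ?thesis unfolding k_def by (intro continuous_intros contc) auto
  qed
  have eq: "f' z w = integral {0..1} (\<lambda>t. f (z + c t *s w) * k t)" if z: "z \<in> ball z0 (e/2)" for z
  proof -
    define F where "F = (\<lambda>\<zeta>. f (z + \<zeta> *s w))"
    have F: "(F has_field_derivative f' (z + \<zeta> *s w) w) (at \<zeta>)" if "norm \<zeta> \<le> r" for \<zeta>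
      unfolding F_def using inS[OF z that] by (intro has_derivative_complex_line der) (auto simp: lin)
    have "continuous_on (cball 0 r) F"
      by (auto intro!: continuous_at_imp_continuous_on DERIV_isCont F)
    moreover have "F holomorphic_on ball 0 r"
      using F unfolding holomorphic_on_open[OF open_ball] by (metis less_imp_le mem_ball_0)
    ultimately have "contour_integral (circlepath 0 r) (\<lambda>u. F u / (u - 0)\<^sup>2) = (2 * pi * \<i>) * deriv F 0"
      using r by (intro Cauchy_contour_integral_circlepath_2) auto
    moreover have "deriv F 0 = f' z w" using DERIV_imp_deriv[OF F[of 0]] r by simp
    ultimately have "f' z w = contour_integral c (\<lambda>u. F u / u\<^sup>2) / (2 * pi * \<i>)"
      by (simp add: c_def)
    also have "\<dots> = integral {0..1} (\<lambda>t. F (c t) / (c t)\<^sup>2 * vector_derivative c (at t)) / (2 * pi * \<i>)"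
      by (simp add: contour_integral_integral)
    also have "\<dots> = integral {0..1} (\<lambda>t. F (c t) / (c t)\<^sup>2 * vector_derivative c (at t) / (2 * pi * \<i>))"
      by (rule integral_divide[symmetric])
    also have "\<dots> = integral {0..1} (\<lambda>t. f (z + c t *s w) * k t)"
      by (intro arg_cong2[where f = integral] refl) (simp add: F_def k_def)
    finally show ?thesis .
  qed
  show thesis
    by (rule that[of "ball z0 (e/2)" c k]) (use e inS c_norm contc contk eq in \<open>auto intro: subsetD[OF e(2)]\<close>)
qed

text \<open>First bootstrapping step: continuity of \<open>f\<close> suffices to get a continuous
  derivative from Cauchy's formula, and this continuity is what the Leibniz rule needs in
  \<open>complex_differentiable_directional_derivative\<close>.\<close>

lemma continuous_on_directional_derivative:
  fixes f :: "complex ^ 'k \<Rightarrow> complex"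
  assumes "open S"
    and der: "\<And>z. z \<in> S \<Longrightarrow> (f has_derivative f' z) (at z)"
    and lin: "\<And>z c v. z \<in> S \<Longrightarrow> f' z (c *s v) = c * f' z v"
  shows "continuous_on S (\<lambda>z. f' z w)"
proof -
  have contf: "continuous_on S f"
    using der by (auto intro!: continuous_at_imp_continuous_on intro: has_derivative_continuous)
  have "isCont (\<lambda>z. f' z w) z0" if z0: "z0 \<in> S" for z0
  proof -
    obtain U c k where U: "open U" "convex U" "z0 \<in> U" "U \<subseteq> S"
      and c: "continuous_on {0..1} c" and k: "continuous_on {0..1} k"
      and inS: "\<And>z t. z \<in> U \<Longrightarrow> t \<in> {0..1::real} \<Longrightarrow> z + c t *s w \<in> S"
      and eq: "\<And>z. z \<in> U \<Longrightarrow> f' z w = integral {0..1} (\<lambda>t. f (z + c t *s w) * k t)"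
      by (rule directional_derivative_Cauchy[OF assms(1) z0 der lin]) (assumption | rule that; assumption)+
    have "continuous_on (U \<times> cbox 0 1) (\<lambda>(z, t). f (z + c t *s w) * k t)"
      unfolding case_prod_beta
      by (intro continuous_intros continuous_on_compose2[OF contf] continuous_on_compose2[OF c]
          continuous_on_compose2[OF k] continuous_on_vector_scalar) (auto simp: inS)
    then have "continuous_on U (\<lambda>z. integral (cbox 0 1) (\<lambda>t. f (z + c t *s w) * k t))"
      by (rule integral_continuous_on_param)
    then have "continuous_on U (\<lambda>z. f' z w)"
      using eq by (simp cong: continuous_on_cong)
    then show ?thesis using U continuous_on_eq_continuous_at by blast
  qed
  then show ?thesis by (simp add: continuous_at_imp_continuous_on)
qed

lemma complex_differentiable_directional_derivative:
  fixes f :: "complex ^ 'k \<Rightarrow> complex"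
  assumes "open S" and z0: "z0 \<in> S"
    and der: "\<And>z. z \<in> S \<Longrightarrow> (f has_derivative f' z) (at z)"
    and lin: "\<And>z c v. z \<in> S \<Longrightarrow> f' z (c *s v) = c * f' z v"
  shows "complex_differentiable_at (\<lambda>z. f' z w) z0"
proof -
  have contf: "continuous_on S f"
    using der by (auto intro!: continuous_at_imp_continuous_on intro: has_derivative_continuous)
  have contf': "continuous_on S (\<lambda>z. f' z v)" for v
    by (rule continuous_on_directional_derivative[OF assms(1) der lin])
  obtain U c k where U: "open U" "convex U" "z0 \<in> U" "U \<subseteq> S"
    and c: "continuous_on {0..1} c" and k: "continuous_on {0..1} k"
    and inS: "\<And>z t. z \<in> U \<Longrightarrow> t \<in> {0..1::real} \<Longrightarrow> z + c t *s w \<in> S"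
    and eq: "\<And>z. z \<in> U \<Longrightarrow> f' z w = integral {0..1} (\<lambda>t. f (z + c t *s w) * k t)"
    by (rule directional_derivative_Cauchy[OF assms(1) z0 der lin]) (assumption | rule that; assumption)+
  \<comment> \<open>The Leibniz rule wants the derivative as a bounded linear map continuous in
    \<open>(z, t)\<close>; in finite dimension continuity can be tested vector by vector.
    \<open>Blinfun\<close> is used only where its argument is bounded linear.\<close>
  define G where "G z t = Blinfun (\<lambda>h. f' (z + c t *s w) h * k t)" for z t
  have G: "blinfun_apply (G z t) h = f' (z + c t *s w) h * k t" if "z \<in> U" "t \<in> {0..1}" for z t h
  proof -
    have "bounded_linear (\<lambda>h. f' (z + c t *s w) h * k t)"
      using has_derivative_bounded_linear[OF der[OF inS[OF that]]] by (rule bounded_linear_mult_const)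
    then show ?thesis unfolding G_def by (simp add: bounded_linear_Blinfun_apply)
  qed
  have contG: "continuous_on (U \<times> cbox 0 1) (\<lambda>(z, t). G z t)"
  proof (rule continuous_on_blinfun_componentwise)
    fix h :: "complex ^ 'k"
    have "continuous_on (U \<times> cbox 0 1) (\<lambda>x. f' (fst x + c (snd x) *s w) h * k (snd x))"
      by (intro continuous_intros continuous_on_compose2[OF contf'] continuous_on_compose2[OF c]
          continuous_on_compose2[OF k] continuous_on_vector_scalar) (auto simp: inS)
    then show "continuous_on (U \<times> cbox 0 1) (\<lambda>x. blinfun_apply (case x of (z, t) \<Rightarrow> G z t) h)"
      by (rule continuous_on_eq) (auto simp: G)
  qed
  have contF: "continuous_on (cbox 0 1) (\<lambda>t. f (z + c t *s w) * k t)" if "z \<in> U" for z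
    using c k that
    by (intro continuous_intros continuous_on_compose2[OF contf] continuous_on_vector_scalar) (auto simp: inS)
  have "((\<lambda>z. integral (cbox 0 1) (\<lambda>t. f (z + c t *s w) * k t)) has_derivative
      blinfun_apply (integral (cbox 0 1) (G z0))) (at z0 within U)"
  proof (rule leibniz_rule[OF _ _ contG U(3,2)])
    fix z t assume zt: "z \<in> U" "t \<in> cbox (0::real) 1"
    have "((\<lambda>z. f (z + c t *s w) * k t) has_derivative (\<lambda>h. f' (z + c t *s w) h * k t)) (at z)"
    proof -
      have "((\<lambda>z. z + c t *s w) has_derivative (\<lambda>h. h)) (at z)"
        by (auto intro!: derivative_eq_intros)
      from has_derivative_compose[OF this der] show ?thesis
        using inS zt by (intro has_derivative_mult_left) auto
    qed
    then show "((\<lambda>z. f (z + c t *s w) * k t) has_derivative blinfun_apply (G z t)) (at z within U)"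
      using zt by (metis (no_types, lifting) G ext has_derivative_at_withinI box_real(2))
  qed (intro integrable_continuous contF)
  then have der2: "((\<lambda>z. f' z w) has_derivative blinfun_apply (integral (cbox 0 1) (G z0))) (at z0)"
    using eq U by (subst (asm) at_within_open) (auto intro: has_derivative_transform_within_open)
  have "continuous_on (cbox 0 (1::real)) (\<lambda>t. (z0, t))"
    by (intro continuous_intros)
  from continuous_on_compose2[OF contG this] have "continuous_on (cbox 0 1) (\<lambda>t. G z0 t)"
    using U by auto
  then have int: "G z0 integrable_on cbox 0 1" by (rule integrable_continuous)
  have "blinfun_apply (integral (cbox 0 1) (G z0)) (a *s v) = a * blinfun_apply (integral (cbox 0 1) (G z0)) v" for a v
  proof -
    have "integral (cbox 0 1) (\<lambda>t. blinfun_apply (G z0 t) (a *s v)) = integral (cbox 0 1) (\<lambda>t. a * blinfun_apply (G z0 t) v)"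
      by (rule integral_cong) (use U inS in \<open>auto simp: G lin\<close>)
    then show ?thesis by (simp add: blinfun_apply_integral[OF int, simplified])
  qed
  with der2 show ?thesis unfolding complex_differentiable_at_def by blast
qed

lemma complex_differentiable_holomorphic_jacobian:
  assumes "holomorphic_map_on f S" "z \<in> S"
  shows "complex_differentiable_at (\<lambda>z. holomorphic_jacobian f z $ i $ j) z"
proof -
  have "complex_differentiable_at (\<lambda>z. (holomorphic_jacobian f z *v axis j 1) $ i) z"
    using assms
    by (intro complex_differentiable_directional_derivative[where f = "\<lambda>z. f z $ i"
        and f' = "\<lambda>z h. (holomorphic_jacobian f z *v h) $ i" and S = S]
        has_derivative_vec_nth holomorphic_jacobian_works)
      (auto simp: holomorphic_map_on_def vector_scalar_commute)
  moreover have "(A *v axis j 1) $ i = A $ i $ j" for A :: "complex ^ 'a ^ 'b"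
    by (simp add: matrix_vector_mult_def axis_def if_distrib cong: if_cong)
  ultimately show ?thesis by simp
qed

section \<open>Transport along a transversal vector field\<close>

text \<open>The method of characteristics for a field that is merely continuous: instead of
  following integral curves back to \<open>\<rho> = 0\<close>, an interior maximum of a weighted
  \<phi> is excluded. The other side of the hypersurface follows by symmetry.\<close>

lemma transport_vanishing_one_side:
  fixes \<rho> \<phi> :: "'a::euclidean_space \<Rightarrow> real" and b :: "'a \<Rightarrow> 'a"
  assumes "open B" and q: "q \<in> B"
    and \<rho>: "\<And>z. z \<in> B \<Longrightarrow> (\<rho> has_derivative \<rho>' z) (at z)"
    and \<phi>: "\<And>z. z \<in> B \<Longrightarrow> (\<phi> has_derivative \<phi>' z) (at z)"
    and cont: "continuous_on B b" "continuous_on B (\<lambda>z. \<rho>' z (b z))"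
    and transport: "\<And>z. z \<in> B \<Longrightarrow> \<phi>' z (b z) = 0"
    and zero: "\<And>z. z \<in> B \<Longrightarrow> \<rho> z = 0 \<Longrightarrow> \<phi> z = 0"
    and q0: "\<rho> q = 0" "\<rho>' q (b q) > 0"
  shows "\<exists>e>0. \<forall>z\<in>ball q e. \<rho> z \<ge> 0 \<longrightarrow> \<phi> z = 0"
proof -
  define c where "c = \<rho>' q (b q) / 2"
  have c: "c > 0" using q0 by (simp add: c_def)
  have "open (B \<inter> (\<lambda>z. \<rho>' z (b z)) -` {c<..})"
    by (rule continuous_open_preimage[OF cont(2) \<open>open B\<close> open_greaterThan])
  moreover have "q \<in> B \<inter> (\<lambda>z. \<rho>' z (b z)) -` {c<..}" using q q0 by (simp add: c_def)
  ultimately obtain \<delta> where \<delta>: "\<delta> > 0" "cball q \<delta> \<subseteq> B \<inter> (\<lambda>z. \<rho>' z (b z)) -` {c<..}"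
    using open_contains_cball by metis
  then have inB: "z \<in> B" and slope: "\<rho>' z (b z) > c" if "z \<in> cball q \<delta>" for z
    using that by auto
  have "continuous_on (cball q \<delta>) b" using cont(1) inB by (meson continuous_on_subset subsetI)
  then have "bounded (b ` cball q \<delta>)"
    by (intro compact_imp_bounded compact_continuous_image compact_cball)
  then obtain C where C: "C > 0" "\<And>z. z \<in> cball q \<delta> \<Longrightarrow> norm (b z) \<le> C"
    by (auto simp: bounded_pos)
  \<comment> \<open>Makes the quadratic term of \<sigma> change at rate at most
    \<open>2 * K * \<delta> * C = c / 2\<close> along \<open>b\<close>, less than the slope
    \<open>c\<close> of \<rho>.\<close>
  define K where "K = c / (4 * \<delta> * C)"
  have K: "K > 0" using c C \<delta> by (simp add: K_def)
  \<comment> \<open>Below \<open>K * \<delta>\<^sup>2\<close>: with \<rho> nonnegative, the bound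
    \<open>\<sigma> z \<le> \<epsilon>\<close> keeps \<open>z\<close> off the sphere of radius
    \<delta>.\<close>
  define \<epsilon> where "\<epsilon> = K * \<delta>\<^sup>2 / 2"
  have \<epsilon>: "\<epsilon> > 0" "\<epsilon> < K * \<delta>\<^sup>2" using K \<delta> by (auto simp: \<epsilon>_def)
  text \<open>Maximum principle on the lens \<open>D\<close> below: moving along \<open>- b\<close> stays in \<open>D\<close> and strictly increases
    \<open>\<phi>\<^sup>2 exp (- \<rho>)\<close> wherever \<open>\<phi>\<close> does not vanish, so no such point can be a maximum.\<close>
  define \<sigma> where "\<sigma> z = \<rho> z + K * ((z - q) \<bullet> (z - q))" for z
  define m where "m z = (\<phi> z)\<^sup>2 * exp (- \<rho> z)" for z
  define D where "D = {z \<in> cball q \<delta>. 0 \<le> \<rho> z \<and> \<sigma> z \<le> \<epsilon>}"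
  have cont\<rho>: "continuous_on (cball q \<delta>) \<rho>"
    using \<rho> inB by (meson continuous_at_imp_continuous_on has_derivative_continuous)
  have cont\<phi>: "continuous_on (cball q \<delta>) \<phi>"
    using \<phi> inB by (meson continuous_at_imp_continuous_on has_derivative_continuous)
  have cont\<sigma>: "continuous_on (cball q \<delta>) \<sigma>"
    unfolding \<sigma>_def by (intro continuous_intros cont\<rho>)
  have "D = (cball q \<delta> \<inter> \<rho> -` {0..}) \<inter> (cball q \<delta> \<inter> \<sigma> -` {..\<epsilon>})" by (auto simp: D_def)
  moreover have "closed (cball q \<delta> \<inter> \<rho> -` {0..})" "closed (cball q \<delta> \<inter> \<sigma> -` {..\<epsilon>})"
    by (auto intro!: continuous_closed_preimage cont\<rho> cont\<sigma>)
  ultimately have compD: "compact D"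
    by (metis closed_Int compact_Int_closed compact_cball inf.assoc inf.idem inf_left_commute)
  have vanish: "\<phi> z1 = 0" if z1: "z1 \<in> D" for z1
  proof (rule ccontr)
    assume ne: "\<phi> z1 \<noteq> 0"
    have contm: "continuous_on D m"
      unfolding m_def D_def
      by (intro continuous_intros continuous_on_subset[OF cont\<rho>] continuous_on_subset[OF cont\<phi>]) auto
    obtain z0 where z0: "z0 \<in> D" "\<And>z. z \<in> D \<Longrightarrow> m z \<le> m z0"
      using continuous_attains_sup[OF compD _ contm] z1 by blast
    have "m z1 > 0" using ne by (simp add: m_def)
    then have "m z0 > 0" using z0(2)[OF z1] by simp
    then have \<phi>0: "\<phi> z0 \<noteq> 0" by (auto simp: m_def)
    have z0d: "z0 \<in> cball q \<delta>" "\<rho> z0 \<ge> 0" "\<sigma> z0 \<le> \<epsilon>" using z0(1) by (auto simp: D_def)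
    have \<rho>0: "\<rho> z0 > 0" using zero[OF inB[OF z0d(1)]] \<phi>0 z0d(2) by fastforce
    have "K * (dist q z0)\<^sup>2 < K * \<delta>\<^sup>2"
      using z0d \<epsilon> by (simp add: \<sigma>_def dist_commute[of q] dist_norm[of z0] power2_norm_eq_inner)
    then have z0in: "dist q z0 < \<delta>" using K \<delta> by (simp add: power_less_imp_less_base)
    define \<gamma> where "\<gamma> t = z0 + t *\<^sub>R (- b z0)" for t
    have \<gamma>: "(\<gamma> has_derivative (\<lambda>h. h *\<^sub>R (- b z0))) (at 0)"
      unfolding \<gamma>_def by (auto intro!: derivative_eq_intros)
    have \<gamma>0: "\<gamma> 0 = z0" by (simp add: \<gamma>_def)
    have dneg: "(\<lambda>h. \<rho>' z0 (h *\<^sub>R (- b z0))) = (*) (- \<rho>' z0 (b z0))"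
        "(\<lambda>h. \<phi>' z0 (h *\<^sub>R (- b z0))) = (*) 0"
      using \<rho>[OF inB[OF z0d(1)]] \<phi>[OF inB[OF z0d(1)]] transport[OF inB[OF z0d(1)]]
      by (auto simp: has_derivative_linear linear_scale linear_neg)
    have d\<rho>: "((\<lambda>t. \<rho> (\<gamma> t)) has_real_derivative - \<rho>' z0 (b z0)) (at 0)"
      using has_derivative_compose[OF \<gamma>, of \<rho> "\<rho>' z0"] \<rho>[OF inB[OF z0d(1)]]
      unfolding \<gamma>0 dneg has_field_derivative_def by simp
    have d\<phi>: "((\<lambda>t. \<phi> (\<gamma> t)) has_real_derivative 0) (at 0)"
      using has_derivative_compose[OF \<gamma>, of \<phi> "\<phi>' z0"] \<phi>[OF inB[OF z0d(1)]]
      unfolding \<gamma>0 dneg has_field_derivative_def by simp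
    have dm: "((\<lambda>t. m (\<gamma> t)) has_real_derivative (\<phi> z0)\<^sup>2 * exp (- \<rho> z0) * \<rho>' z0 (b z0)) (at 0)"
      unfolding m_def by (rule derivative_eq_intros d\<rho> d\<phi> | simp add: \<gamma>0)+
    have d\<sigma>: "((\<lambda>t. \<sigma> (\<gamma> t)) has_real_derivative - \<rho>' z0 (b z0) - 2 * K * ((z0 - q) \<bullet> b z0)) (at 0)"
    proof -
      have "(\<gamma> t - q) \<bullet> (\<gamma> t - q) = (z0 - q) \<bullet> (z0 - q) - 2 * t * ((z0 - q) \<bullet> b z0) + t\<^sup>2 * (b z0 \<bullet> b z0)" for t
        by (simp add: \<gamma>_def inner_diff_left inner_diff_right inner_add_left inner_add_right
            inner_commute power2_eq_square algebra_simps)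
      then show ?thesis unfolding \<sigma>_def
        by (simp only:) (rule derivative_eq_intros d\<rho> | simp)+
    qed
    have "\<bar>(z0 - q) \<bullet> b z0\<bar> \<le> \<delta> * C"
      using Cauchy_Schwarz_ineq2[of "z0 - q" "b z0"] C(2)[OF z0d(1)] C(1) z0d(1) \<delta>(1)
        mult_mono[of "norm (z0 - q)" \<delta> "norm (b z0)" C]
      by (simp add: dist_norm norm_minus_commute)
    then have "2 * K * \<bar>(z0 - q) \<bullet> b z0\<bar> \<le> 2 * K * (\<delta> * C)" using K by simp
    also have "\<dots> = c / 2" using \<delta> C by (simp add: K_def)
    finally have "\<bar>2 * K * ((z0 - q) \<bullet> b z0)\<bar> \<le> c / 2" using K by (simp add: abs_mult)
    then have \<sigma>neg: "- \<rho>' z0 (b z0) - 2 * K * ((z0 - q) \<bullet> b z0) < 0"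
      using slope[OF z0d(1)] c by linarith
    obtain d1 where d1: "d1 > 0" "\<And>h. 0 < h \<Longrightarrow> h < d1 \<Longrightarrow> m z0 < m (\<gamma> h)"
      using DERIV_pos_inc_right[OF dm] slope[OF z0d(1)] c \<phi>0 by (auto simp: \<gamma>0)
    obtain d2 where d2: "d2 > 0" "\<And>h. 0 < h \<Longrightarrow> h < d2 \<Longrightarrow> \<sigma> (\<gamma> h) < \<sigma> z0"
      using DERIV_neg_dec_right[OF d\<sigma> \<sigma>neg] by (auto simp: \<gamma>0)
    have "isCont (\<lambda>t. \<rho> (\<gamma> t)) 0" using d\<rho> by (rule DERIV_isCont)
    then have "\<forall>\<^sub>F t in at_right 0. \<rho> (\<gamma> t) > 0"
      using \<rho>0 by (intro order_tendstoD(1)[of _ "\<rho> z0"]) (auto simp: isCont_def \<gamma>0 intro: tendsto_within_subset)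
    moreover have "isCont (\<lambda>t. dist q (\<gamma> t)) 0"
      unfolding \<gamma>_def by (intro continuous_intros)
    then have "\<forall>\<^sub>F t in at_right 0. dist q (\<gamma> t) < \<delta>"
      using z0in by (intro order_tendstoD(2)[of _ "dist q z0"]) (auto simp: isCont_def \<gamma>0 intro: tendsto_within_subset)
    moreover have "\<forall>\<^sub>F t in at_right (0::real). 0 < t \<and> t < d1 \<and> t < d2"
      using d1(1) d2(1) by (auto simp: eventually_at_right_field intro!: exI[of _ "min d1 d2"])
    ultimately have "\<forall>\<^sub>F t in at_right 0. \<rho> (\<gamma> t) > 0 \<and> dist q (\<gamma> t) < \<delta> \<and> 0 < t \<and> t < d1 \<and> t < d2"
      by eventually_elim simp
    then obtain t where t: "\<rho> (\<gamma> t) > 0" "dist q (\<gamma> t) < \<delta>" "0 < t" "t < d1" "t < d2"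
      using eventually_happens'[OF trivial_limit_at_right_real] by blast
    have "\<gamma> t \<in> D" using t d2(2)[OF t(3,5)] z0d by (auto simp: D_def)
    then show False using z0(2) d1(2)[OF t(3,4)] by fastforce
  qed
  \<comment> \<open>Since \<open>\<sigma> q = 0 < \<epsilon>\<close>, the lens contains every point
    near \<open>q\<close> with \<rho> nonnegative.\<close>
  have "isCont \<sigma> q"
    using cont\<sigma> \<delta>(1) by (metis centre_in_ball continuous_on_eq_continuous_at continuous_on_subset ball_subset_cball open_ball)
  then have "(\<sigma> \<longlongrightarrow> \<sigma> q) (nhds q)" by (simp add: isCont_def tendsto_at_iff_tendsto_nhds)
  moreover have "\<sigma> q < \<epsilon>" using \<epsilon> q0 by (simp add: \<sigma>_def)
  ultimately have "\<forall>\<^sub>F z in nhds q. \<sigma> z < \<epsilon>" by (rule order_tendstoD(2))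
  then obtain e where e: "e > 0" "\<And>z. dist z q < e \<Longrightarrow> \<sigma> z < \<epsilon>"
    by (auto simp: eventually_nhds_metric)
  show ?thesis
  proof (intro exI[of _ "min e \<delta>"] conjI ballI impI)
    fix z assume "z \<in> ball q (min e \<delta>)" "\<rho> z \<ge> 0"
    then show "\<phi> z = 0" using e(2)[of z] by (intro vanish) (auto simp: D_def dist_commute)
  qed (use e \<delta> in auto)
qed

text \<open>The side \<open>\<rho> \<le> 0\<close> is the one-sided case for \<open>- \<rho>\<close>
  and \<open>- b\<close>, as \<rho> and \<open>b\<close> changing sign together preserve the slope;
  a negative slope is made positive by reversing \<open>b\<close> alone.\<close>

lemma transport_vanishing:
  fixes \<rho> \<phi> :: "'a::euclidean_space \<Rightarrow> real" and b :: "'a \<Rightarrow> 'a"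
  assumes "open B" and q: "q \<in> B"
    and \<rho>: "\<And>z. z \<in> B \<Longrightarrow> (\<rho> has_derivative \<rho>' z) (at z)"
    and \<phi>: "\<And>z. z \<in> B \<Longrightarrow> (\<phi> has_derivative \<phi>' z) (at z)"
    and cont: "continuous_on B b" "continuous_on B (\<lambda>z. \<rho>' z (b z))"
    and transport: "\<And>z. z \<in> B \<Longrightarrow> \<phi>' z (b z) = 0"
    and zero: "\<And>z. z \<in> B \<Longrightarrow> \<rho> z = 0 \<Longrightarrow> \<phi> z = 0"
    and q0: "\<rho> q = 0" "\<rho>' q (b q) \<noteq> 0"
  shows "\<forall>\<^sub>F z in nhds q. \<phi> z = 0"
proof -
  have pos: "\<forall>\<^sub>F z in nhds q. \<phi> z = 0"
    if b: "continuous_on B b" "continuous_on B (\<lambda>z. \<rho>' z (b z))" "\<And>z. z \<in> B \<Longrightarrow> \<phi>' z (b z) = 0"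
      "\<rho>' q (b q) > 0" for b
  proof -
    have neg: "\<rho>' z (- b z) = - \<rho>' z (b z)" "\<phi>' z (- b z) = - \<phi>' z (b z)" if "z \<in> B" for z
      using \<rho>[OF that] \<phi>[OF that] by (simp_all add: has_derivative_linear linear_neg)
    have "\<exists>e>0. \<forall>z\<in>ball q e. \<rho> z \<ge> 0 \<longrightarrow> \<phi> z = 0"
      by (rule transport_vanishing_one_side[OF assms(1) q, where \<rho>' = \<rho>' and \<phi>' = \<phi>' and b = b])
        (use \<rho> \<phi> b zero q0 in auto)
    then obtain e1 where e1: "e1 > 0" "\<forall>z\<in>ball q e1. \<rho> z \<ge> 0 \<longrightarrow> \<phi> z = 0" by blast
    have "\<exists>e>0. \<forall>z\<in>ball q e. - \<rho> z \<ge> 0 \<longrightarrow> \<phi> z = 0"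
    proof (rule transport_vanishing_one_side[OF assms(1) q, where \<rho>' = "\<lambda>z h. - \<rho>' z h" and \<phi>' = \<phi>' and b = "\<lambda>z. - b z"])
      show "continuous_on B (\<lambda>z. - \<rho>' z (- b z))"
        using b(2) by (rule continuous_on_eq) (simp add: neg)
    qed (use \<rho> \<phi> b zero q0 q neg in \<open>auto intro: has_derivative_minus continuous_on_minus\<close>)
    then obtain e2 where e2: "e2 > 0" "\<forall>z\<in>ball q e2. - \<rho> z \<ge> 0 \<longrightarrow> \<phi> z = 0" by blast
    show ?thesis unfolding eventually_nhds_metric
    proof (intro exI[of _ "min e1 e2"] conjI allI impI)
      fix z assume "dist z q < min e1 e2"
      then show "\<phi> z = 0" using e1(2) e2(2) by (cases "\<rho> z \<ge> 0") (auto simp: dist_commute)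
    qed (use e1 e2 in auto)
  qed
  show ?thesis
  proof (cases "\<rho>' q (b q) > 0")
    case True
    with cont transport show ?thesis by (intro pos)
  next
    case False
    have neg: "\<rho>' z (- b z) = - \<rho>' z (b z)" "\<phi>' z (- b z) = - \<phi>' z (b z)" if "z \<in> B" for z
      using \<rho>[OF that] \<phi>[OF that] by (simp_all add: has_derivative_linear linear_neg)
    show ?thesis
    proof (rule pos[of "\<lambda>z. - b z"])
      show "continuous_on B (\<lambda>z. \<rho>' z (- b z))"
        using continuous_on_minus[OF cont(2)] by (rule continuous_on_eq) (simp add: neg)
    qed (use False q0 q cont transport neg in \<open>auto intro: continuous_on_minus\<close>)
  qed
qed

section \<open>Hypersurfaces as uniqueness sets\<close>

text \<open>A sign change of \<rho> between two points on either side of \<open>q\<close> persists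
  under small shifts, imaginary ones included. This reduces the claim to the one-variable identity
  theorem on complex lines parallel to \<open>v\<close>, without representing the hypersurface as a
  graph.\<close>

lemma holomorphic_vanishing_on_hypersurface:
  fixes g :: "complex ^ 'k \<Rightarrow> complex" and \<rho> :: "complex ^ 'k \<Rightarrow> real"
  assumes "open W" and q: "q \<in> W"
    and g: "\<And>z. z \<in> W \<Longrightarrow> complex_differentiable_at g z"
    and cont: "continuous_on W \<rho>"
    and \<rho>: "(\<rho> has_derivative L) (at q)" "L \<noteq> (\<lambda>v. 0)" "\<rho> q = 0"
    and zero: "\<And>z. z \<in> W \<Longrightarrow> \<rho> z = 0 \<Longrightarrow> g z = 0"
  shows "\<forall>\<^sub>F z in nhds q. g z = 0"
proof -
  obtain v0 where "L v0 \<noteq> 0" using \<rho>(2) by auto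
  then obtain v where v: "L v > 0"
    using linear_neg[OF has_derivative_linear[OF \<rho>(1)], of v0]
    by (metis neg_0_less_iff_less linorder_neqE_linordered_idom)
  obtain e where e: "e > 0" "ball q e \<subseteq> W" using \<open>open W\<close> q openE by blast
  have inW: "z + \<zeta> *s v \<in> W" if "dist z q < e / 2" "norm \<zeta> * norm v < e / 2" for z \<zeta>
  proof -
    have "dist q (z + \<zeta> *s v) \<le> dist q z + dist z (z + \<zeta> *s v)" by (rule dist_triangle)
    moreover have "dist z (z + \<zeta> *s v) = norm \<zeta> * norm v"
      by (simp add: dist_norm norm_vector_scalar_mult)
    ultimately have "dist q (z + \<zeta> *s v) < e" using that by (simp add: dist_commute)
    then show ?thesis using e by auto
  qed
  define N where "N = norm v + 1"
  have N: "N > 0" by (simp add: N_def add_nonneg_pos)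
  define \<delta> where "\<delta> = e / (4 * N)"
  have \<delta>: "\<delta> > 0" using e N by (simp add: \<delta>_def)
  have \<delta>v: "2 * \<delta> * norm v < e / 2"
  proof -
    have "4 * \<delta> * N = e" using N by (simp add: \<delta>_def)
    then show ?thesis using \<delta> by (simp add: N_def algebra_simps)
  qed
  have inW': "z + \<zeta> *s v \<in> W" if "dist z q < e / 2" "norm \<zeta> < 2 * \<delta>" for z \<zeta>
    using inW[OF that(1)] mult_right_mono[of "norm \<zeta>" "2 * \<delta>" "norm v"] that(2) \<delta>v by simp
  have line: "(q + of_real t *s v) = q + t *\<^sub>R v" for t :: real
    by (simp add: vec_eq_iff scaleR_conv_of_real[where 'a = complex])
  have "((\<lambda>t. q + t *\<^sub>R v) has_derivative (\<lambda>h. h *\<^sub>R v)) (at 0)"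
    by (auto intro!: derivative_eq_intros)
  from has_derivative_compose[OF this, of \<rho> L]
  have d: "((\<lambda>t. \<rho> (q + t *\<^sub>R v)) has_real_derivative L v) (at 0)"
    using \<rho>(1) linear_scale[OF has_derivative_linear[OF \<rho>(1)]]
    by (simp add: has_field_derivative_def mult_commute_abs)
  obtain d1 where d1: "d1 > 0" "\<And>h. 0 < h \<Longrightarrow> h < d1 \<Longrightarrow> \<rho> (q + h *\<^sub>R v) > 0"
    using DERIV_pos_inc_right[OF d v] \<rho>(3) by auto
  obtain d2 where d2: "d2 > 0" "\<And>h. 0 < h \<Longrightarrow> h < d2 \<Longrightarrow> \<rho> (q - h *\<^sub>R v) < 0"
    using DERIV_pos_inc_left[OF d v] \<rho>(3) by auto
  \<comment> \<open>Strictly below \<open>d1\<close> and \<open>d2\<close>, so both ends have strict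
    signs. With \<open>s0\<close> also at most \<open>\<delta> / 2\<close>, all parameters used lie
    in the compact disc of radius \<delta>, inside the domain of \<open>G\<close>.\<close>
  define t0 where "t0 = min (\<delta> / 2) (min d1 d2 / 2)"
  have t0: "t0 > 0" "t0 \<le> \<delta> / 2" "\<rho> (q + of_real t0 *s v) > 0" "\<rho> (q + of_real (- t0) *s v) < 0"
    using \<delta> d1 d2 by (auto simp: t0_def line simp del: of_real_minus)
  have contW: "isCont \<rho> z" if "z \<in> W" for z
    using cont \<open>open W\<close> that continuous_on_eq_continuous_at by blast
  have "q + of_real t0 *s v \<in> W" "q + of_real (- t0) *s v \<in> W"
    using e(1) t0 \<delta> by (intro inW'; simp)+
  with t0 have "\<forall>\<^sub>F z in nhds (q + of_real t0 *s v). \<rho> z > 0" "\<forall>\<^sub>F z in nhds (q + of_real (- t0) *s v). \<rho> z < 0"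
    by (auto intro!: order_tendstoD(1)[of _ "\<rho> (q + of_real t0 *s v)"]
        order_tendstoD(2)[of _ "\<rho> (q + of_real (- t0) *s v)"] contW[unfolded isCont_def tendsto_at_iff_tendsto_nhds]
        simp del: of_real_minus)
  then obtain \<eta>1 \<eta>2 where \<eta>1: "\<eta>1 > 0" "\<And>z. dist z (q + of_real t0 *s v) < \<eta>1 \<Longrightarrow> \<rho> z > 0"
    and \<eta>2: "\<eta>2 > 0" "\<And>z. dist z (q + of_real (- t0) *s v) < \<eta>2 \<Longrightarrow> \<rho> z < 0"
    unfolding eventually_nhds_metric by metis
  define \<eta> where "\<eta> = min (min \<eta>1 \<eta>2) e / 2"
  have \<eta>: "\<eta> > 0" "\<eta> \<le> e / 2" "2 * \<eta> \<le> \<eta>1" "2 * \<eta> \<le> \<eta>2" using \<eta>1 \<eta>2 e by (auto simp: \<eta>_def)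
  \<comment> \<open>An imaginary shift below \<open>s0\<close> and the passage from \<open>q\<close>
    to \<open>z\<close> each move a point by less than \<eta>, together less than
    \<open>2 * \<eta>\<close>, where the signs at both ends persist.\<close>
  define s0 where "s0 = min (\<delta> / 2) (\<eta> / N)"
  have s0: "s0 > 0" "s0 \<le> \<delta> / 2" "s0 \<le> \<eta> / N"
  proof -
    show "s0 > 0" using \<delta> \<eta> N unfolding s0_def by simp
    show "s0 \<le> \<delta> / 2" "s0 \<le> \<eta> / N" unfolding s0_def by (rule min.cobounded1, rule min.cobounded2)
  qed
  have s0v: "s0 * norm v < \<eta>"
  proof -
    have "s0 * norm v \<le> \<eta> / N * norm v" using s0(3) by (intro mult_right_mono) auto
    also have "\<dots> < \<eta>" using \<eta>(1) N by (simp add: field_simps) (simp add: N_def)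
    finally show ?thesis .
  qed
  have "g z = 0" if z: "dist z q < \<eta>" for z
  proof -
    define G where "G = (\<lambda>\<zeta>. g (z + \<zeta> *s v))"
    have zW: "z + \<zeta> *s v \<in> W" if "norm \<zeta> < 2 * \<delta>" for \<zeta>
      using inW'[OF _ that] z \<eta>(2) by simp
    have hol: "G holomorphic_on ball 0 (2 * \<delta>)"
      unfolding holomorphic_on_open[OF open_ball]
    proof
      fix \<zeta> :: complex assume "\<zeta> \<in> ball 0 (2 * \<delta>)"
      then have "complex_differentiable_at g (z + \<zeta> *s v)" by (intro g zW) simp
      then show "\<exists>f'. (G has_field_derivative f') (at \<zeta>)"
        unfolding complex_differentiable_at_def G_def using has_derivative_complex_line by blast
    qed
    text \<open>By the intermediate value theorem the complex line through \<open>z\<close> in the transversal direction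
      \<open>v\<close> meets the hypersurface at parameters of every small imaginary part, hence infinitely often.\<close>
    have ex: "\<exists>t. \<bar>t\<bar> \<le> t0 \<and> G (Complex t s) = 0" if s: "0 < s" "s < s0" for s
    proof -
      have near: "dist (z + Complex t s *s v) (q + of_real t *s v) < 2 * \<eta>" for t
      proof -
        have "(z + Complex t s *s v) - (q + of_real t *s v) = (z - q) + (\<i> * of_real s) *s v"
          by (simp add: vec_eq_iff Complex_eq algebra_simps)
        then have "dist (z + Complex t s *s v) (q + of_real t *s v) \<le> norm (z - q) + norm ((\<i> * of_real s) *s v)"
          by (metis dist_norm norm_triangle_ineq)
        also have "norm ((\<i> * of_real s) *s v) = s * norm v"
          using s by (simp add: norm_vector_scalar_mult norm_mult)
        also have "s * norm v \<le> s0 * norm v" using s by (intro mult_right_mono) auto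
        finally show ?thesis using z s0v by (simp add: dist_norm)
      qed
      have norm: "norm (Complex t s) \<le> \<delta>" if "\<bar>t\<bar> \<le> t0" for t
        using cmod_le[of "Complex t s"] that s s0 t0 by simp
      have "\<rho> (z + Complex t0 s *s v) > 0" "\<rho> (z + Complex (- t0) s *s v) < 0"
        using near[of t0] near[of "- t0"] \<eta> by (auto intro!: \<eta>1(2) \<eta>2(2))
      moreover have "continuous_on {- t0..t0} (\<lambda>t. z + Complex t s *s v)"
        unfolding Complex_eq by (intro continuous_intros continuous_on_vector_scalar)
      then have "continuous_on {- t0..t0} (\<lambda>t. \<rho> (z + Complex t s *s v))"
      proof (rule continuous_on_compose2[OF cont])
        show "(\<lambda>t. z + Complex t s *s v) ` {- t0..t0} \<subseteq> W"
        proof (rule image_subsetI)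
          fix t assume "t \<in> {- t0..t0}"
          then have "\<bar>t\<bar> \<le> t0" by auto
          then show "z + Complex t s *s v \<in> W" using norm[of t] \<delta> by (intro zW) simp
        qed
      qed
      ultimately obtain t where t: "- t0 \<le> t" "t \<le> t0" "\<rho> (z + Complex t s *s v) = 0"
        using IVT'[of "\<lambda>t. \<rho> (z + Complex t s *s v)" "- t0" 0 t0] t0(1) by auto
      then have "\<bar>t\<bar> \<le> t0" by simp
      then have "G (Complex t s) = 0" unfolding G_def
        using norm[of t] t \<delta> by (intro zero zW) simp_all
      then show ?thesis using t by (intro exI[of _ t]) auto
    qed
    define Z where "Z = {\<zeta> \<in> cball 0 \<delta>. G \<zeta> = 0}"
    have "{0<..<s0} \<subseteq> Im ` Z"
    proof
      fix s assume "s \<in> {0<..<s0}"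
      then obtain t where t: "\<bar>t\<bar> \<le> t0" "G (Complex t s) = 0" using ex by auto
      then have "Complex t s \<in> Z"
        using cmod_le[of "Complex t s"] s0 t0 \<open>s \<in> {0<..<s0}\<close> by (simp add: Z_def)
      then show "s \<in> Im ` Z" by force
    qed
    then have "infinite Z" using s0 by (meson finite_imageI finite_subset infinite_Ioo)
    then obtain \<xi> where \<xi>: "\<xi> \<in> cball 0 \<delta>" "\<xi> islimpt Z"
      using compact_cball[of "0::complex" \<delta>] unfolding compact_eq_Bolzano_Weierstrass Z_def
      by (metis (no_types, lifting) mem_Collect_eq subsetI)
    have "G 0 = 0"
      by (rule analytic_continuation[OF hol open_ball connected_ball _ _ \<xi>(2)])
        (use \<xi>(1) \<delta> in \<open>auto simp: Z_def\<close>)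
    then show ?thesis by (simp add: G_def)
  qed
  then show ?thesis using \<eta>(1) unfolding eventually_nhds_metric by blast
qed

section \<open>Real-analytic functions\<close>

text \<open>Unordered summation over the multi-indices is absolute, so they may be enumerated.
  Evaluation at a corner of a cube inside the ball then dominates the terms on the whole
  cube.\<close>

lemma real_analytic_expansion:
  fixes f :: "'a::euclidean_space \<Rightarrow> real"
  assumes "real_analytic_on f S" "p \<in> S"
  obtains s :: real and c :: "nat \<Rightarrow> real" and A :: "nat \<Rightarrow> 'a \<Rightarrow> nat" where "s > 0"
    "summable (\<lambda>n. \<bar>c n\<bar> * s ^ (\<Sum>b\<in>Basis. A n b))"
    "\<And>x. \<forall>b\<in>Basis. \<bar>(x - p) \<bullet> b\<bar> \<le> s \<Longrightarrow>
       (\<lambda>n. c n * (\<Prod>b\<in>Basis. ((x - p) \<bullet> b) ^ A n b)) sums f x"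
proof -
  let ?I = "Basis \<rightarrow>\<^sub>E UNIV :: ('a \<Rightarrow> nat) set"
  obtain r C where r: "r > 0" and C: "\<And>x. x \<in> ball p r \<Longrightarrow>
      ((\<lambda>\<alpha>. C \<alpha> * (\<Prod>b\<in>Basis. ((x - p) \<bullet> b) ^ \<alpha> b)) has_sum f x) ?I"
    using assms unfolding real_analytic_on_def by metis
  have "countable ?I" by (rule countable_PiE) auto
  moreover have "infinite ?I"
  proof
    assume "finite ?I"
    obtain b0 :: 'a where b0: "b0 \<in> Basis" using nonempty_Basis by blast
    have "(UNIV :: nat set) \<subseteq> (\<lambda>\<alpha>. \<alpha> b0) ` ?I"
    proof
      fix n :: nat
      have "restrict (\<lambda>_. n) Basis \<in> ?I" by auto
      then show "n \<in> (\<lambda>\<alpha>. \<alpha> b0) ` ?I" using b0 by (intro image_eqI[of _ _ "restrict (\<lambda>_. n) Basis"]) auto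
    qed
    then show False using \<open>finite ?I\<close> by (meson finite_imageI finite_subset infinite_UNIV_nat)
  qed
  ultimately obtain e :: "('a \<Rightarrow> nat) \<Rightarrow> nat" where e: "bij_betw e ?I UNIV" by (rule countableE_infinite)
  define A where "A = inv_into ?I e"
  have A: "bij_betw A UNIV ?I" unfolding A_def by (rule bij_betw_inv_into[OF e])
  define c where "c n = C (A n)" for n
  \<comment> \<open>By the l1 bound on the norm, the cube of half-width \<open>s\<close> lies within
    distance \<open>r / 2\<close> of \<open>p\<close>.\<close>
  define s where "s = r / (2 * DIM('a))"
  have s: "s > 0" using r by (simp add: s_def)
  have inball: "x \<in> ball p r" if "\<forall>b\<in>Basis. \<bar>(x - p) \<bullet> b\<bar> \<le> s" for x
  proof -
    have "norm (x - p) \<le> (\<Sum>b\<in>Basis. \<bar>(x - p) \<bullet> b\<bar>)" by (rule norm_le_l1)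
    also have "\<dots> \<le> DIM('a) * s" using that by (intro sum_bounded_above) auto
    also have "\<dots> < r" using r by (simp add: s_def)
    finally show ?thesis by (simp add: dist_norm norm_minus_commute)
  qed
  have hs: "((\<lambda>n. c n * (\<Prod>b\<in>Basis. ((x - p) \<bullet> b) ^ A n b)) has_sum f x) UNIV"
    if "\<forall>b\<in>Basis. \<bar>(x - p) \<bullet> b\<bar> \<le> s" for x
    using C[OF inball[OF that]] unfolding c_def
    by (subst has_sum_reindex_bij_betw[OF A, where f = "\<lambda>\<alpha>. C \<alpha> * (\<Prod>b\<in>Basis. ((x - p) \<bullet> b) ^ \<alpha> b)"])
  have "((p + s *\<^sub>R (\<Sum>Basis)) - p) \<bullet> b = s" if "b \<in> Basis" for b
    using that by (simp add: inner_sum_left_Basis)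
  then have "(\<lambda>n. c n * (\<Prod>b\<in>(Basis::'a set). s ^ A n b)) summable_on UNIV"
    using hs[of "p + s *\<^sub>R (\<Sum>Basis)"] s by (auto simp: summable_on_def intro!: exI)
  then have "(\<lambda>n. c n * s ^ (\<Sum>b\<in>Basis. A n b)) summable_on UNIV"
    by (simp add: power_sum)
  then have "(\<lambda>n. norm (c n * s ^ (\<Sum>b\<in>Basis. A n b))) summable_on UNIV"
    by (rule summable_on_iff_abs_summable_on_real[THEN iffD1])
  then have "summable (\<lambda>n. \<bar>c n\<bar> * s ^ (\<Sum>b\<in>Basis. A n b))"
    using s by (auto dest!: summable_on_imp_summable simp: abs_mult)
  with s hs show thesis by (intro that[of s c A] has_sum_imp_sums) auto
qed

text \<open>Termwise differentiation on a smaller ball: halving the radius gains a factor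
  \<open>2 ^ N\<close> in degree \<open>N\<close>, which absorbs the factor \<open>N\<close>
  produced by differentiating.\<close>

lemma real_analytic_C1_local:
  fixes f :: "'a::euclidean_space \<Rightarrow> real"
  assumes "real_analytic_on f S" "p \<in> S"
  shows "\<exists>d>0. \<exists>f'. (\<forall>x\<in>ball p d. (f has_derivative f' x) (at x)) \<and>
           (\<forall>h. continuous_on (ball p d) (\<lambda>x. f' x h))"
proof -
  obtain s c A where s: "s > 0" and summ: "summable (\<lambda>n. \<bar>c n\<bar> * s ^ (\<Sum>b\<in>Basis. A n b))"
    and sums: "\<And>x. \<forall>b\<in>Basis. \<bar>(x - p) \<bullet> b\<bar> \<le> s \<Longrightarrow>
       (\<lambda>n. c n * (\<Prod>b\<in>Basis. ((x - p) \<bullet> b) ^ A n b)) sums f x"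
    by (rule real_analytic_expansion[OF assms]) (assumption | rule that; assumption)+
  define T where "T n x = c n * (\<Prod>b\<in>Basis. ((x - p) \<bullet> b) ^ A n b)" for n x
  define T' where "T' n x h = c n * (\<Sum>b\<in>Basis. of_nat (A n b) * (h \<bullet> b) * ((x - p) \<bullet> b) ^ (A n b - 1) *
      (\<Prod>b'\<in>Basis - {b}. ((x - p) \<bullet> b') ^ A n b'))" for n x h
  \<comment> \<open>The factor \<open>2 / s\<close> restores the power lost in differentiating:
    \<open>(s / 2) ^ (N - 1) = (2 / s) * (s / 2) ^ N\<close>.\<close>
  define M where "M n = (2 / s) * (\<bar>c n\<bar> * s ^ (\<Sum>b\<in>Basis. A n b))" for n
  let ?B = "ball p (s/2)"
  have coord: "\<bar>(x - p) \<bullet> b\<bar> \<le> s / 2" if "x \<in> ?B" "b \<in> Basis" for x b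
    using Basis_le_norm[OF that(2), of "x - p"] that(1) by (simp add: dist_norm norm_minus_commute)
  have T': "(T n has_derivative T' n x) (at x)" for n x
  proof -
    have "((\<lambda>x. (x - p) \<bullet> b) has_derivative (\<lambda>h. h \<bullet> b)) (at x)" for b
      by (auto intro!: derivative_eq_intros)
    from has_derivative_mult_right[OF has_derivative_prod[OF has_derivative_power[OF this]]]
    show ?thesis unfolding T_def T'_def .
  qed
  have summM: "summable M" unfolding M_def by (intro summable_mult summ)
  have bound: "norm (T' n x h) \<le> M n * norm h" if x: "x \<in> ?B" for n x h
  proof -
    let ?N = "\<Sum>b\<in>Basis. A n b"
    have one: "\<bar>of_nat (A n b) * (h \<bullet> b) * ((x - p) \<bullet> b) ^ (A n b - 1) *
        (\<Prod>b'\<in>Basis - {b}. ((x - p) \<bullet> b') ^ A n b')\<bar> \<le> real (A n b) * norm h * (2 / s) * (s / 2) ^ ?N"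
      if b: "b \<in> Basis" for b
    proof (cases "A n b = 0")
      \<comment> \<open>For exponent 0 the factor \<open>of_nat (A n b)\<close> vanishes, so the
        truncated \<open>A n b - 1\<close> is harmless.\<close>
      case False
      have "\<bar>(\<Prod>b'\<in>Basis - {b}. ((x - p) \<bullet> b') ^ A n b')\<bar> \<le> (\<Prod>b'\<in>Basis - {b}. (s / 2) ^ A n b')"
        unfolding abs_prod power_abs using coord[OF x] by (intro prod_mono) (auto simp: power_abs intro!: power_mono)
      moreover have "\<bar>((x - p) \<bullet> b) ^ (A n b - 1)\<bar> \<le> (s / 2) ^ (A n b - 1)"
        unfolding power_abs using coord[OF x b] by (intro power_mono) auto
      moreover have "\<bar>h \<bullet> b\<bar> \<le> norm h" by (rule Basis_le_norm[OF b])
      ultimately have "\<bar>of_nat (A n b) * (h \<bullet> b) * ((x - p) \<bullet> b) ^ (A n b - 1) *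
          (\<Prod>b'\<in>Basis - {b}. ((x - p) \<bullet> b') ^ A n b')\<bar>
          \<le> real (A n b) * norm h * (s / 2) ^ (A n b - 1) * (\<Prod>b'\<in>Basis - {b}. (s / 2) ^ A n b')"
        unfolding abs_mult using s by (intro mult_mono) auto
      also have "\<dots> = real (A n b) * norm h * (2 / s) * ((s / 2) ^ A n b * (\<Prod>b'\<in>Basis - {b}. (s / 2) ^ A n b'))"
        using False s by (cases "A n b") auto
      also have "(s / 2) ^ A n b * (\<Prod>b'\<in>Basis - {b}. (s / 2) ^ A n b') = (s / 2) ^ ?N"
        using b by (simp add: power_sum prod.remove)
      finally show ?thesis .
    qed simp
    have "norm (T' n x h) \<le> \<bar>c n\<bar> * (\<Sum>b\<in>Basis. real (A n b) * norm h * (2 / s) * (s / 2) ^ ?N)"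
      unfolding T'_def real_norm_def abs_mult[of "c n"]
      by (intro mult_left_mono order_trans[OF sum_abs] sum_mono one) auto
    also have "\<dots> = \<bar>c n\<bar> * (real ?N * norm h * (2 / s) * (s / 2) ^ ?N)"
      by (simp only: of_nat_sum sum_distrib_right)
    also have "\<dots> = (\<bar>c n\<bar> * norm h * (2 / s) * s ^ ?N) * (real ?N / 2 ^ ?N)"
      by (simp add: power_divide)
    also have "\<dots> \<le> (\<bar>c n\<bar> * norm h * (2 / s) * s ^ ?N) * 1"
    proof (intro mult_left_mono)
      have "real ?N \<le> 2 ^ ?N" using of_nat_mono[OF less_imp_le[OF less_exp[of ?N]], where 'a = real] by simp
      then show "real ?N / 2 ^ ?N \<le> 1" by simp
    qed (use s in auto)
    finally show ?thesis by (simp add: M_def mult_ac)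
  qed
  define g' where "g' x h = (\<Sum>n. T' n x h)" for x h
  have summT': "summable (\<lambda>n. T' n x h)" if "x \<in> ?B" for x h
    by (rule summable_comparison_test'[OF summable_mult2[OF summM], of 0]) (rule bound[OF that])
  have sumsT: "(\<lambda>n. T n x) sums f x" if "x \<in> ?B" for x
    unfolding T_def
    by (rule sums) (use coord[OF that] s in fastforce)
  have p: "p \<in> ?B" using s by simp
  have "\<exists>g. \<forall>x\<in>?B. (\<lambda>n. T n x) sums g x \<and> (g has_derivative g' x) (at x within ?B)"
  proof (rule has_derivative_series[where f = T and f' = T' and g' = g', OF convex_ball _ _ p sumsT[OF p]])
    show "(T n has_derivative T' n x) (at x within ?B)" for n x
      using T' by (rule has_derivative_at_withinI)
    fix e :: real assume "e > 0"
    from suminf_exist_split[OF this summM] obtain N where N: "\<And>n. n \<ge> N \<Longrightarrow> norm (\<Sum>i. M (i + n)) < e"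
      by blast
    show "\<forall>\<^sub>F n in sequentially. \<forall>x\<in>?B. \<forall>h. norm ((\<Sum>i<n. T' i x h) - g' x h) \<le> e * norm h"
    proof (rule eventually_sequentiallyI[of N], intro ballI allI)
      fix n x h assume n: "n \<ge> N" and x: "x \<in> ?B"
      have sM: "summable (\<lambda>i. M (i + n))" using summM by (simp add: summable_iff_shift)
      have "norm ((\<Sum>i<n. T' i x h) - g' x h) = norm (\<Sum>i. T' (i + n) x h)"
        unfolding g'_def suminf_minus_initial_segment[OF summT'[OF x]] by (simp add: abs_minus_commute)
      also have "\<dots> \<le> (\<Sum>i. M (i + n) * norm h)"
        by (rule norm_suminf_le) (use bound[OF x] sM in \<open>auto intro: summable_mult2\<close>)
      also have "\<dots> = (\<Sum>i. M (i + n)) * norm h" by (rule suminf_mult2[symmetric, OF sM])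
      also have "\<dots> \<le> e * norm h" using N[OF n] by (intro mult_right_mono) auto
      finally show "norm ((\<Sum>i<n. T' i x h) - g' x h) \<le> e * norm h" .
    qed
  qed
  then obtain g where g: "\<And>x. x \<in> ?B \<Longrightarrow> (\<lambda>n. T n x) sums g x"
    "\<And>x. x \<in> ?B \<Longrightarrow> (g has_derivative g' x) (at x within ?B)" by blast
  have "(f has_derivative g' x) (at x)" if x: "x \<in> ?B" for x
  proof (rule has_derivative_transform_within_open[OF _ open_ball x])
    show "(g has_derivative g' x) (at x)" using g(2)[OF x] unfolding at_within_open[OF x open_ball] .
    show "g y = f y" if "y \<in> ?B" for y by (rule sums_unique2[OF g(1)[OF that] sumsT[OF that]])
  qed
  moreover have "continuous_on ?B (\<lambda>x. g' x h)" for h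
  proof (rule uniform_limit_theorem)
    show "uniform_limit ?B (\<lambda>n x. \<Sum>i<n. T' i x h) (\<lambda>x. g' x h) sequentially"
      unfolding g'_def by (rule Weierstrass_m_test[OF bound summable_mult2[OF summM]])
    show "\<forall>\<^sub>F n in sequentially. continuous_on ?B (\<lambda>x. \<Sum>i<n. T' i x h)"
      unfolding T'_def by (intro always_eventually allI continuous_intros)
  qed simp
  ultimately show ?thesis using s by (intro exI[of _ "s/2"] conjI exI[of _ g']) auto
qed

lemma real_analytic_has_derivative:
  assumes "real_analytic_on f S" "p \<in> S"
  shows "(f has_derivative frechet_derivative f (at p)) (at p)"
proof -
  obtain d f' where "d > 0" "\<forall>x\<in>ball p d. (f has_derivative f' x) (at x)"
    using real_analytic_C1_local[OF assms] by blast
  then have "f differentiable at p" by (auto simp: differentiable_def)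
  then show ?thesis by (rule frechet_derivative_works[THEN iffD1])
qed

lemma real_analytic_continuous_derivative:
  fixes f :: "'a::euclidean_space \<Rightarrow> real"
  assumes f: "real_analytic_on f S" and B: "B \<subseteq> S" and a: "continuous_on B a"
  shows "continuous_on B (\<lambda>z. frechet_derivative f (at z) (a z))"
proof -
  have "isCont (\<lambda>z. frechet_derivative f (at z) h) p" if p: "p \<in> S" for p h
  proof -
    obtain d f' where d: "d > 0" "\<And>x. x \<in> ball p d \<Longrightarrow> (f has_derivative f' x) (at x)"
      "continuous_on (ball p d) (\<lambda>x. f' x h)"
      using real_analytic_C1_local[OF f p] by blast
    have "continuous_on (ball p d) (\<lambda>z. frechet_derivative f (at z) h)"
      using d(3) by (rule continuous_on_eq) (simp add: frechet_derivative_at[OF d(2)])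
    then show ?thesis using d(1) by (simp add: continuous_on_eq_continuous_at[OF open_ball])
  qed
  then have cont: "continuous_on B (\<lambda>z. frechet_derivative f (at z) h)" for h
    using B by (auto intro!: continuous_at_imp_continuous_on)
  have "continuous_on B (\<lambda>z. \<Sum>i\<in>Basis. (a z \<bullet> i) * frechet_derivative f (at z) i)"
    by (intro continuous_intros a cont)
  then show ?thesis
  proof (rule continuous_on_eq)
    fix z assume "z \<in> B"
    then have lin: "linear (frechet_derivative f (at z))"
      using real_analytic_has_derivative[OF f] B has_derivative_linear by blast
    have "frechet_derivative f (at z) (a z) = frechet_derivative f (at z) (\<Sum>i\<in>Basis. (a z \<bullet> i) *\<^sub>R i)"
      by (simp add: euclidean_representation)
    then show "(\<Sum>i\<in>Basis. (a z \<bullet> i) * frechet_derivative f (at z) i) = frechet_derivative f (at z) (a z)"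
      using lin by (simp add: linear_sum linear_scale)
  qed
qed

text \<open>The segment from \<open>q\<close> to \<open>z\<close> lies in the complex line
  \<open>q + t *s (z - q)\<close>. Along it \<open>f (H _)\<close> is the restriction to real
  \<open>t\<close> of a holomorphic \<open>F\<close>, whose vanishing near \<open>t = 0\<close>
  propagates to \<open>t = 1\<close>.\<close>

lemma real_analytic_holomorphic_identity:
  fixes f :: "complex ^ 'l \<Rightarrow> real" and H :: "complex ^ 'k \<Rightarrow> complex ^ 'l"
  assumes f: "real_analytic_on f S" and H: "holomorphic_map_on H U" and p: "p \<in> U" "H p \<in> S"
  shows "\<exists>\<delta>>0. ball p \<delta> \<subseteq> U \<and> H ` ball p \<delta> \<subseteq> S \<and>
    (\<forall>q\<in>ball p \<delta>. (\<forall>\<^sub>F z in nhds q. f (H z) = 0) \<longrightarrow> (\<forall>z\<in>ball p \<delta>. f (H z) = 0))"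
proof -
  have "open U" "open S" using f H by (auto simp: real_analytic_on_def holomorphic_map_on_def)
  have contH: "isCont H z" if "z \<in> U" for z
    using holomorphic_jacobian_works[OF H that] has_derivative_continuous by blast
  obtain s c A where s: "s > 0" and summ: "summable (\<lambda>n. \<bar>c n\<bar> * s ^ (\<Sum>b\<in>Basis. A n b))"
    and sums: "\<And>x. \<forall>b\<in>Basis. \<bar>(x - H p) \<bullet> b\<bar> \<le> s \<Longrightarrow>
       (\<lambda>n. c n * (\<Prod>b\<in>Basis. ((x - H p) \<bullet> b) ^ A n b)) sums f x"
    by (rule real_analytic_expansion[OF f p(2)]) (rule that; assumption)
  obtain \<kappa> where \<kappa>: "\<kappa> > 0" "ball (H p) \<kappa> \<subseteq> S" using \<open>open S\<close> p openE by blast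
  \<comment> \<open>Each of the \<open>CARD('l)\<close> summands of \<open>G\<close> below is at
    most \<kappa>', which puts the complexified coordinates within the radius \<open>s\<close> of
    convergence.\<close>
  define \<kappa>' where "\<kappa>' = min \<kappa> (s / CARD('l))"
  have \<kappa>': "\<kappa>' > 0" "\<kappa>' \<le> \<kappa>" "\<kappa>' * CARD('l) \<le> s"
  proof -
    show "\<kappa>' > 0" using \<kappa> s by (simp add: \<kappa>'_def)
    have "\<kappa>' \<le> s / CARD('l)" by (simp add: \<kappa>'_def)
    then show "\<kappa>' * CARD('l) \<le> s" by (simp add: pos_le_divide_eq)
  qed (simp add: \<kappa>'_def)
  obtain \<delta>1 where \<delta>1: "\<delta>1 > 0" "ball p \<delta>1 \<subseteq> U" using \<open>open U\<close> p openE by blast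
  obtain \<delta>2 where \<delta>2: "\<delta>2 > 0" "\<And>z. dist z p < \<delta>2 \<Longrightarrow> dist (H z) (H p) < \<kappa>'"
    using contH[OF p(1)] \<kappa>'(1) unfolding continuous_at_eps_delta by blast
  \<comment> \<open>Factor 5: \<open>q\<close> is within \<delta> of \<open>p\<close>,
    \<open>norm v < 2 * \<delta>\<close>, and \<open>t\<close> runs over a disc of radius 2.\<close>
  define \<delta> where "\<delta> = min \<delta>1 \<delta>2 / 5"
  have \<delta>: "\<delta> > 0" "5 * \<delta> \<le> \<delta>1" "5 * \<delta> \<le> \<delta>2" using \<delta>1 \<delta>2 by (auto simp: \<delta>_def)
  have inU: "z \<in> U" and near: "norm (H z - H p) < \<kappa>'" if "dist p z < 5 * \<delta>" for z
    using that \<delta> \<delta>1(2) \<delta>2(2)[of z] by (auto simp: dist_commute dist_norm[symmetric])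
  have "f (H z) = 0"
    if q: "q \<in> ball p \<delta>" "\<forall>\<^sub>F z in nhds q. f (H z) = 0" and z: "z \<in> ball p \<delta>" for q z
  proof -
    define v where "v = z - q"
    have v: "norm v < 2 * \<delta>"
      using q z dist_triangle2[of z q p] by (simp add: v_def dist_norm[symmetric] dist_commute)
    let ?D = "ball (0::complex) 2"
    have inball: "dist p (q + t *s v) < 5 * \<delta>" if "t \<in> ?D" for t
    proof -
      have "dist p (q + t *s v) \<le> dist p q + dist q (q + t *s v)" by (rule dist_triangle)
      also have "dist q (q + t *s v) = norm t * norm v" by (simp add: dist_norm norm_vector_scalar_mult)
      also have "norm t * norm v \<le> 2 * norm v" using that by (intro mult_right_mono) auto
      finally show ?thesis using v q(1) by simp
    qed
    \<comment> \<open>Hermitian pairing with \<open>b\<close>: only constants are conjugated, so it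
      is holomorphic in \<open>t\<close>, and its real part is the real inner product with
      \<open>b\<close>.\<close>
    define G where "G b t = (\<Sum>j\<in>UNIV. (H (q + t *s v) $ j - H p $ j) * cnj (b $ j))" for b t
    text \<open>The real coordinates of \<open>H\<close> along the line are extended holomorphically in \<open>t\<close>.\<close>
    define w where "w b t = (G b t + cnj (G b (cnj t))) / 2" for b t
    have holG: "G b holomorphic_on ?D" for b
    proof -
      have "(\<lambda>t. H (q + t *s v) $ j) holomorphic_on ?D" for j
        unfolding holomorphic_on_open[OF open_ball]
      proof
        fix t assume "t \<in> ?D"
        then have "complex_differentiable_at (\<lambda>x. H x $ j) (q + t *s v)"
          by (intro holomorphic_map_on_component[OF H] inU inball)
        then show "\<exists>f'. ((\<lambda>t. H (q + t *s v) $ j) has_field_derivative f') (at t)"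
          unfolding complex_differentiable_at_def using has_derivative_complex_line by blast
      qed
      then show ?thesis unfolding G_def by (intro holomorphic_intros)
    qed
    \<comment> \<open>Schwarz reflection: conjugating both argument and value preserves holomorphy
      on a disc symmetric about the real axis.\<close>
    have holw: "w b holomorphic_on ?D" for b
    proof -
      have "(cnj \<circ> G b \<circ> cnj) holomorphic_on ?D"
        by (rule holomorphic_on_compose_cnj_cnj[OF holomorphic_on_subset[OF holG]]) auto
      then show ?thesis unfolding w_def using holG by (intro holomorphic_intros) (auto simp: o_def)
    qed
    have normG: "norm (G b t) \<le> s" if t: "t \<in> ?D" and b: "b \<in> Basis" for b t
    proof -
      have "norm (G b t) \<le> (\<Sum>j\<in>(UNIV::'l set). \<kappa>')" unfolding G_def
      proof (rule sum_norm_le)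
        fix j
        have "norm ((H (q + t *s v) - H p) $ j) \<le> norm (H (q + t *s v) - H p)"
          by (rule Finite_Cartesian_Product.norm_nth_le)
        moreover have "norm (b $ j) \<le> 1" using Finite_Cartesian_Product.norm_nth_le[of b j] b by simp
        ultimately show "norm ((H (q + t *s v) $ j - H p $ j) * cnj (b $ j)) \<le> \<kappa>'"
          using \<kappa>'(1) near[OF inball[OF t]] mult_mono[of "norm (H (q + t *s v) $ j - H p $ j)" \<kappa>' "norm (b $ j)" 1]
          by (simp add: norm_mult)
      qed
      also have "\<dots> \<le> s" using \<kappa>'(3) by (simp add: mult.commute)
      finally show ?thesis .
    qed
    have normw: "norm (w b t) \<le> s" if "t \<in> ?D" "b \<in> Basis" for b t
    proof -
      have "norm (w b t) \<le> (norm (G b t) + norm (G b (cnj t))) / 2"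
        using norm_triangle_ineq[of "G b t" "cnj (G b (cnj t))"] by (simp add: w_def norm_divide)
      also have "\<dots> \<le> (s + s) / 2"
        by (intro divide_right_mono add_mono normG that) (use that(1) in auto)
      finally show ?thesis by simp
    qed
    have w_real: "w b (of_real t) = of_real ((H (q + of_real t *s v) - H p) \<bullet> b)" for b t
    proof -
      have "w b (of_real t) = of_real (Re (G b (of_real t)))"
        by (simp add: w_def complex_add_cnj)
      also have "Re (G b (of_real t)) = (H (q + of_real t *s v) - H p) \<bullet> b"
        by (simp add: G_def inner_vec_def inner_complex_def)
      finally show ?thesis .
    qed
    define T where "T n t = of_real (c n) * (\<Prod>b\<in>Basis. w b t ^ A n b)" for n t
    define F where "F t = (\<Sum>n. T n t)" for t
    have lim: "uniform_limit ?D (\<lambda>n t. \<Sum>i<n. T i t) F sequentially"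
      unfolding F_def
    proof (rule Weierstrass_m_test[OF _ summ])
      fix n t assume t: "t \<in> ?D"
      have "(\<Prod>b\<in>Basis. norm (w b t) ^ A n b) \<le> (\<Prod>b\<in>Basis. s ^ A n b)"
        using normw[OF t] by (intro prod_mono) (auto intro: power_mono)
      then show "norm (T n t) \<le> \<bar>c n\<bar> * s ^ (\<Sum>b\<in>Basis. A n b)"
        unfolding T_def norm_mult prod_norm[symmetric] norm_power power_sum
        by (simp add: mult_left_mono)
    qed
    have holF: "F holomorphic_on ?D"
    proof (rule holomorphic_uniform_sequence[OF open_ball])
      show "(\<lambda>t. \<Sum>i<n. T i t) holomorphic_on ?D" for n
        unfolding T_def by (intro holomorphic_intros holw)
      fix t assume "t \<in> ?D"
      then obtain d where "d > 0" "cball t d \<subseteq> ?D" using open_ball open_contains_cball by metis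
      then show "\<exists>d>0. cball t d \<subseteq> ?D \<and> uniform_limit (cball t d) (\<lambda>n t. \<Sum>i<n. T i t) F sequentially"
        using uniform_limit_on_subset[OF lim] by blast
    qed
    have F_real: "F (of_real t) = of_real (f (H (q + of_real t *s v)))" if t: "of_real t \<in> ?D" for t
    proof -
      have "\<forall>b\<in>Basis. \<bar>(H (q + of_real t *s v) - H p) \<bullet> b\<bar> \<le> s"
        using normw[OF t] unfolding w_real norm_of_real by blast
      from sums_of_real[OF sums[OF this], where 'a = complex]
      have "(\<lambda>n. T n (of_real t)) sums of_real (f (H (q + of_real t *s v)))"
        by (simp add: T_def w_real)
      then show ?thesis by (simp add: F_def sums_iff)
    qed
    obtain \<eta> where \<eta>: "\<eta> > 0" "\<And>y. dist y q < \<eta> \<Longrightarrow> f (H y) = 0"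
      using q(2) unfolding eventually_nhds_metric by blast
    define N where "N = norm v + 1"
    have N: "N > 0" by (simp add: N_def add_nonneg_pos)
    define t0 where "t0 = min 1 (\<eta> / N)"
    have t0: "t0 > 0" using \<eta> N by (simp add: t0_def)
    let ?Z = "of_real ` {0<..<t0} :: complex set"
    have Z: "F t = 0 \<and> t \<in> ?D" if t: "t \<in> ?Z" for t
    proof -
      obtain r where r: "t = of_real r" "0 < r" "r < t0" using t by auto
      have D: "t \<in> ?D" using r by (simp add: t0_def)
      have "dist (q + of_real r *s v) q = r * norm v" using r by (simp add: dist_norm norm_vector_scalar_mult)
      also have "\<dots> \<le> r * N" using r by (intro mult_left_mono) (auto simp: N_def)
      also have "\<dots> < \<eta>" using r N by (simp add: t0_def pos_less_divide_eq)
      finally show ?thesis using F_real[of r] D \<eta>(2) r(1) by simp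
    qed
    have "0 islimpt ?Z"
      unfolding islimpt_approachable
    proof (intro allI impI)
      fix e :: real assume "e > 0"
      define r where "r = min e t0 / 2"
      have "0 < r" "r < e" "r < t0" using \<open>e > 0\<close> t0 by (auto simp: r_def)
      then show "\<exists>x'\<in>?Z. x' \<noteq> 0 \<and> dist x' 0 < e" by (intro bexI[of _ "of_real r"]) auto
    qed
    moreover have "?Z \<subseteq> ?D" "\<And>t. t \<in> ?Z \<Longrightarrow> F t = 0" using Z by blast+
    ultimately have "F 1 = 0"
      by (intro analytic_continuation[OF holF open_ball connected_ball, of ?Z 0 1]) auto
    then show ?thesis using F_real[of 1] by (simp add: v_def)
  qed
  moreover have "z \<in> U" "H z \<in> S" if "z \<in> ball p \<delta>" for z
  proof -
    have "dist p z < 5 * \<delta>" using that \<delta>(1) by simp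
    then have "z \<in> U" "norm (H z - H p) < \<kappa>'" by (rule inU, rule near)
    then show "z \<in> U" "H z \<in> S" using \<kappa>(2) \<kappa>'(2) by (auto simp: dist_norm norm_minus_commute)
  qed
  ultimately show ?thesis using \<delta>(1) by blast
qed

section \<open>Kernel fields of the Jacobian\<close>

text \<open>A kernel vector \<open>v\<close> at \<open>q\<close> is continued by solving
  \<open>T z *v a z = v\<close>, where \<open>T\<close> depends holomorphically on \<open>z\<close>
  and \<open>T q\<close> is the identity. Off \<open>M\<close> the rank may exceed that at
  \<open>q\<close>, so the kernel equation is obtained on \<open>M\<close> only.\<close>

lemma holomorphic_kernel_field:
  fixes H :: "complex ^ 'k \<Rightarrow> complex ^ 'l"
  assumes H: "holomorphic_map_on H B" and q: "q \<in> B"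
    and rank_q: "rank (holomorphic_jacobian H q) < CARD('k)"
    and max: "\<And>z. z \<in> M \<inter> B \<Longrightarrow>
      vec.dim (range ((*v) (holomorphic_jacobian H z))) \<le> vec.dim (range ((*v) (holomorphic_jacobian H q)))"
  obtains W a where "open W" "q \<in> W" "W \<subseteq> B" "holomorphic_map_on a W" "a q \<noteq> 0"
    "\<And>z. z \<in> M \<inter> W \<Longrightarrow> holomorphic_jacobian H z *v a z = 0"
proof -
  let ?J = "holomorphic_jacobian H"
  have "open B" using H by (simp add: holomorphic_map_on_def)
  obtain E where E: "?J q ** E ** ?J q = ?J q" using exists_generalized_inverse by blast
  obtain v where v: "v \<noteq> 0" "?J q *v v = 0" using exists_kernel_vector[OF rank_q] by blast
  define T where "T z = mat 1 + E ** (?J z - ?J q)" for z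
  have T: "complex_differentiable_at (\<lambda>z. T z $ i $ j) z" if "z \<in> B" for z i j
  proof -
    have "(\<lambda>z. T z $ i $ j) = (\<lambda>z. mat 1 $ i $ j + (\<Sum>k\<in>UNIV. E $ i $ k * (?J z $ k $ j + (- ?J q $ k $ j))))"
      by (simp add: T_def matrix_matrix_mult_def)
    then show ?thesis
      by (simp only:) (intro complex_differentiable_add complex_differentiable_sum complex_differentiable_mult
          complex_differentiable_const complex_differentiable_holomorphic_jacobian[OF H that])
  qed
  define W where "W = B \<inter> (\<lambda>z. det (T z)) -` (- {0})"
  have "continuous_on B (\<lambda>z. det (T z))"
    by (intro continuous_at_imp_continuous_on ballI complex_differentiable_imp_isCont complex_differentiable_det T)
  then have "open W" unfolding W_def by (rule continuous_open_preimage) (auto simp: \<open>open B\<close>)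
  have "T q = mat 1" by (simp add: T_def matrix_matrix_mult_def vec_eq_iff)
  then have "q \<in> W" using q by (simp add: W_def)
  \<comment> \<open>Cramer's rule: a quotient of determinants, hence visibly holomorphic where
    \<open>det (T z)\<close> is nonzero.\<close>
  define a where "a z = (\<chi> k. det (\<chi> i j. if j = k then v $ i else T z $ i $ j) / det (T z))" for z
  have Ta: "T z *v a z = v" if "z \<in> W" for z
    using cramer[of "T z" "a z" v] that by (auto simp: W_def a_def)
  have "holomorphic_map_on a W"
  proof (rule holomorphic_map_onI[OF \<open>open W\<close>])
    fix z k assume z: "z \<in> W"
    then have "z \<in> B" "det (T z) \<noteq> 0" by (auto simp: W_def)
    have "complex_differentiable_at (\<lambda>z. if j = k then v $ i else T z $ i $ j) z" for i j
      using T[OF \<open>z \<in> B\<close>] complex_differentiable_const by (cases "j = k") simp_all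
    then have "complex_differentiable_at (\<lambda>z. det (\<chi> i j. if j = k then v $ i else T z $ i $ j) * inverse (det (T z))) z"
      using T[OF \<open>z \<in> B\<close>] \<open>det (T z) \<noteq> 0\<close>
      by (intro complex_differentiable_mult complex_differentiable_inverse complex_differentiable_det) simp_all
    then show "complex_differentiable_at (\<lambda>z. a z $ k) z" by (simp add: a_def divide_inverse)
  qed
  moreover have "a q \<noteq> 0" using Ta[OF \<open>q \<in> W\<close>] v(1) by auto
  moreover have "?J z *v a z = 0" if "z \<in> M \<inter> W" for z
    using that by (intro kernel_perturbation[OF E _ max v(2)] Ta[unfolded T_def]) (auto simp: W_def T_def)
  ultimately show thesis using \<open>open W\<close> \<open>q \<in> W\<close> by (intro that[of W a]) (auto simp: W_def)
qed

section \<open>Tangency in terms of real differentials\<close>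

lemma linear_real_coordinates:
  fixes D :: "complex ^ 'k \<Rightarrow> real"
  assumes "linear D"
  shows "D v = (\<Sum>j\<in>UNIV. Re (v $ j) * D (axis j 1) + Im (v $ j) * D (axis j \<i>))"
proof -
  have "v = (\<Sum>j\<in>UNIV. Re (v $ j) *\<^sub>R axis j 1 + Im (v $ j) *\<^sub>R axis j \<i>)"
  proof (subst vec_eq_iff, rule allI)
    fix i
    have "(\<Sum>j\<in>UNIV. Re (v $ j) *\<^sub>R axis j 1 + Im (v $ j) *\<^sub>R axis j \<i>) $ i
        = (\<Sum>j\<in>UNIV. if j = i then v $ i else 0)"
      unfolding sum_component by (intro sum.cong refl) (auto simp: axis_def complex_eq_iff)
    then show "v $ i = (\<Sum>j\<in>UNIV. Re (v $ j) *\<^sub>R axis j 1 + Im (v $ j) *\<^sub>R axis j \<i>) $ i"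
      by simp
  qed
  then have "D v = D (\<Sum>j\<in>UNIV. Re (v $ j) *\<^sub>R axis j 1 + Im (v $ j) *\<^sub>R axis j \<i>)" by simp
  then show ?thesis by (simp add: linear_sum[OF assms] linear_add[OF assms] linear_scale[OF assms])
qed

text \<open>If the (1,0)-field is not tangent at \<open>z\<close>, one of the real directions
  \<open>v\<close>, \<open>\<i> *s v\<close> is thus transversal to the level set of \<rho>.\<close>

lemma sum_dZ:
  assumes "linear (frechet_derivative \<rho> (at z))"
  shows "(\<Sum>j\<in>UNIV. v $ j * dZ j \<rho> z) =
    (of_real (frechet_derivative \<rho> (at z) v) - \<i> * of_real (frechet_derivative \<rho> (at z) (\<i> *s v))) / 2"
  unfolding linear_real_coordinates[OF assms, of v] linear_real_coordinates[OF assms, of "\<i> *s v"] dZ_def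
  by (simp add: complex_eq_iff sum_divide_distrib Re_sum Im_sum sum_subtractf[symmetric] sum_negf[symmetric]
      algebra_simps diff_divide_distrib add_divide_distrib)

lemma local_defining_function_subset:
  assumes "local_defining_function M W \<rho>" "open W'" "W' \<subseteq> W"
  shows "local_defining_function M W' \<rho>"
  using assms unfolding local_defining_function_def real_analytic_on_def by blast

lemma local_image_in_hypersurface:
  fixes M U :: "(complex ^ 'k) set" and M' :: "(complex ^ 'l) set" and H :: "complex ^ 'k \<Rightarrow> complex ^ 'l"
  assumes M: "real_analytic_hypersurface M" and M': "real_analytic_hypersurface M'" and "M \<subseteq> U"
    and nondeg: "holomorphically_nondegenerate M" and H: "holomorphic_map_on H U" and image: "H ` M \<subseteq> M'"
    and rank: "\<And>z. z \<in> M \<Longrightarrow> rank (holomorphic_jacobian H z) < CARD('k)" and p: "p \<in> M"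
  shows "\<exists>e>0. ball p e \<subseteq> U \<and> H ` ball p e \<subseteq> M'"
proof -
  let ?J = "holomorphic_jacobian H"
  obtain W \<rho> where W: "p \<in> W" "local_defining_function M W \<rho>"
    using M p unfolding real_analytic_hypersurface_def by blast
  have \<rho>: "real_analytic_on \<rho> W" "\<And>z. z \<in> W \<Longrightarrow> frechet_derivative \<rho> (at z) \<noteq> (\<lambda>v. 0)"
    "\<And>z. z \<in> W \<Longrightarrow> z \<in> M \<longleftrightarrow> \<rho> z = 0"
    using W(2) unfolding local_defining_function_def by blast+
  have "H p \<in> M'" using image p by blast
  then obtain W' \<rho>' where W': "H p \<in> W'" "local_defining_function M' W' \<rho>'"
    using M' unfolding real_analytic_hypersurface_def by blast
  have \<rho>': "real_analytic_on \<rho>' W'" "\<And>z. z \<in> W' \<Longrightarrow> z \<in> M' \<longleftrightarrow> \<rho>' z = 0"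
    using W'(2) unfolding local_defining_function_def by blast+
  obtain \<delta> where \<delta>: "\<delta> > 0" "ball p \<delta> \<subseteq> U" "H ` ball p \<delta> \<subseteq> W'"
    and identity: "\<And>q z. q \<in> ball p \<delta> \<Longrightarrow> \<forall>\<^sub>F z in nhds q. \<rho>' (H z) = 0 \<Longrightarrow> z \<in> ball p \<delta> \<Longrightarrow> \<rho>' (H z) = 0"
    using real_analytic_holomorphic_identity[OF \<rho>'(1) H subsetD[OF \<open>M \<subseteq> U\<close> p] W'(1)] by blast
  define B where "B = ball p \<delta> \<inter> W"
  have "open W" using \<rho>(1) by (simp add: real_analytic_on_def)
  then have "open B" by (simp add: B_def open_Int)
  have HB: "holomorphic_map_on H B"
    using H \<open>open B\<close> \<delta>(2) unfolding holomorphic_map_on_def B_def by blast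
  \<comment> \<open>Maximized over \<open>M \<inter> B\<close> only: there the rank is known to be
    below \<open>CARD('k)\<close>, so the kernel at the maximum point is nonzero.\<close>
  define d where "d z = vec.dim (range ((*v) (?J z)))" for z
  have "p \<in> M \<inter> B" using p W \<delta> by (simp add: B_def)
  moreover have "\<forall>z. z \<in> M \<inter> B \<longrightarrow> d z \<le> CARD('k)"
    using dim_range_le_rank rank unfolding d_def by (meson IntD1 less_imp_le order_trans)
  ultimately obtain q where q: "q \<in> M \<inter> B" "\<And>z. z \<in> M \<inter> B \<Longrightarrow> d z \<le> d q"
    using ex_has_greatest_nat[of "\<lambda>z. z \<in> M \<inter> B" p d] by (metis less_Suc_eq_le)
  have qM: "q \<in> M" and qB: "q \<in> B" using q(1) by auto
  obtain W1 a where W1: "open W1" "q \<in> W1" "W1 \<subseteq> B" and a: "holomorphic_map_on a W1" "a q \<noteq> 0"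
    and aM: "\<And>z. z \<in> M \<inter> W1 \<Longrightarrow> ?J z *v a z = 0"
    by (rule holomorphic_kernel_field[OF HB qB rank[OF qM] q(2)[unfolded d_def]]) (assumption | rule that; assumption)+
  have conta: "continuous_on W1 a"
    using holomorphic_jacobian_works[OF a(1)] has_derivative_continuous continuous_at_imp_continuous_on by blast
  have cont\<rho>: "continuous_on W1 \<rho>"
  proof (intro continuous_at_imp_continuous_on ballI)
    fix z assume "z \<in> W1"
    then have "z \<in> W" using W1(3) by (auto simp: B_def)
    then show "isCont \<rho> z" by (rule has_derivative_continuous[OF real_analytic_has_derivative[OF \<rho>(1)]])
  qed
  have "\<forall>\<^sub>F z in nhds q. (?J z *v a z) $ i = 0" for i
  proof (rule holomorphic_vanishing_on_hypersurface[OF W1(1,2) _ cont\<rho>])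
    fix z assume z: "z \<in> W1"
    then show "complex_differentiable_at (\<lambda>z. (?J z *v a z) $ i) z"
      using W1(3) unfolding matrix_vector_mult_def
      by (auto intro!: complex_differentiable_sum complex_differentiable_mult
          complex_differentiable_holomorphic_jacobian[OF HB] holomorphic_map_on_component[OF a(1)])
    show "(?J z *v a z) $ i = 0" if "\<rho> z = 0"
      using aM[of z] z that W1(3) \<rho>(3)[of z] by (auto simp: B_def)
  qed (use qM qB \<rho> real_analytic_has_derivative[OF \<rho>(1), of q] in \<open>auto simp: B_def\<close>)
  then have "\<forall>\<^sub>F z in nhds q. \<forall>i. (?J z *v a z) $ i = 0" by (rule eventually_all_finite)
  then have "\<forall>\<^sub>F z in nhds q. ?J z *v a z = 0" by (simp add: vec_eq_iff)
  then obtain W0 where W0: "open W0" "q \<in> W0" "\<And>z. z \<in> W0 \<Longrightarrow> ?J z *v a z = 0"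
    unfolding eventually_nhds by blast
  define W2 where "W2 = W0 \<inter> W1"
  have W2: "open W2" "q \<in> W2" "W2 \<subseteq> W1" "W2 \<subseteq> B" "W2 \<subseteq> W"
    using W0 W1 by (auto simp: W2_def B_def)
  have J: "?J z *v a z = 0" if "z \<in> W2" for z using W0(3) that by (simp add: W2_def)
  have "holomorphic_map_on a W2" using a(1) W2 unfolding holomorphic_map_on_def by blast
  moreover have "local_defining_function M W2 \<rho>" by (rule local_defining_function_subset[OF W(2) W2(1,5)])
  \<comment> \<open>The germ of \<open>a\<close> at \<open>q\<close> is nontrivial, so nondegeneracy
    rules out tangency on \<open>W2\<close>, tested with the given \<rho>.\<close>
  moreover have "\<not> (\<forall>\<^sub>F z in nhds q. a z = 0)" using a(2) eventually_nhds_x_imp_x by fastforce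
  ultimately obtain q' where q': "q' \<in> M \<inter> W2" "(\<Sum>j\<in>UNIV. a q' $ j * dZ j \<rho> q') \<noteq> 0"
    using nondeg qM W2(2) unfolding holomorphically_nondegenerate_def tangent_holomorphic_field_def by blast
  have der: "(\<rho> has_derivative frechet_derivative \<rho> (at z)) (at z)" if "z \<in> W2" for z
    using real_analytic_has_derivative[OF \<rho>(1)] that W2(5) by blast
  have "frechet_derivative \<rho> (at q') (a q') \<noteq> 0 \<or> frechet_derivative \<rho> (at q') (\<i> *s a q') \<noteq> 0"
    using q' sum_dZ[OF has_derivative_linear[OF der], of q' "a q'"] by auto
  \<comment> \<open>\<open>c\<close> is 1 or \<i>; either way \<open>c *s a z\<close> stays in the
    kernel of the Jacobian.\<close>
  then obtain c where c: "frechet_derivative \<rho> (at q') (c *s a q') \<noteq> 0"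
    by (metis vector_smult_lid)
  have contca: "continuous_on W2 (\<lambda>z. c *s a z)"
    using continuous_on_subset[OF conta W2(3)] unfolding vector_scalar_mult_def
    by (intro continuous_on_vec_lambda continuous_intros)
  have "\<forall>\<^sub>F z in nhds q'. \<rho>' (H z) = 0"
  proof (rule transport_vanishing[OF W2(1) _ der _ contca])
    show "q' \<in> W2" using q' by simp
    have HW': "H z \<in> W'" "z \<in> U" if "z \<in> W2" for z using that W2(4) \<delta> by (auto simp: B_def)
    show "((\<lambda>z. \<rho>' (H z)) has_derivative (\<lambda>h. frechet_derivative \<rho>' (at (H z)) (?J z *v h))) (at z)"
      if "z \<in> W2" for z
      by (rule has_derivative_compose[OF holomorphic_jacobian_works[OF H] real_analytic_has_derivative[OF \<rho>'(1)]])
        (use HW'[OF that] in auto)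
    show "continuous_on W2 (\<lambda>z. frechet_derivative \<rho> (at z) (c *s a z))"
      by (rule real_analytic_continuous_derivative[OF \<rho>(1) W2(5) contca])
    show "frechet_derivative \<rho>' (at (H z)) (?J z *v (c *s a z)) = 0" if "z \<in> W2" for z
      using J[OF that] linear_0[OF has_derivative_linear[OF real_analytic_has_derivative[OF \<rho>'(1) HW'(1)[OF that]]]]
      by (simp add: vector_scalar_commute)
    show "\<rho>' (H z) = 0" if "z \<in> W2" "\<rho> z = 0" for z
      using that HW'[OF that(1)] \<rho>(3)[of z] \<rho>'(2)[of "H z"] image W2(5) by blast
    show "\<rho> q' = 0" using q' \<rho>(3) W2(5) by blast
  qed (simp_all add: c)
  \<comment> \<open>\<delta> was fixed before \<open>q'\<close>, so vanishing near \<open>q'\<close>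
    reaches the whole ball about \<open>p\<close>.\<close>
  moreover have "q' \<in> ball p \<delta>" using q' W2(4) by (auto simp: B_def)
  ultimately have "\<rho>' (H z) = 0" if "z \<in> ball p \<delta>" for z using identity that by blast
  then have "H ` ball p \<delta> \<subseteq> M'" using \<delta>(3) \<rho>'(2) by blast
  then show ?thesis using \<delta> by blast
qed

theorem theorem5p1:
  fixes n n' :: nat
    and M U :: "(complex ^ 'k) set"
    and M' :: "(complex ^ 'l) set"
    and H :: "complex ^ 'k \<Rightarrow> complex ^ 'l"
  assumes "CARD('k) = n + 1" and "CARD('l) = n' + 1"
    and "real_analytic_hypersurface M" and "connected M"
    and "real_analytic_hypersurface M'" and "connected M'"
    and "open U" and "M \<subseteq> U"
    and "holomorphically_nondegenerate M"
    and "holomorphic_map_on H U"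
    and "H ` M \<subseteq> M'"
    and "\<forall>p\<in>M. rank (holomorphic_jacobian H p) \<le> n"
  shows "\<exists>V. open V \<and> V \<subseteq> U \<and> M \<subseteq> V \<and> H ` V \<subseteq> M'"
proof -
  have "rank (holomorphic_jacobian H p) < CARD('k)" if "p \<in> M" for p
    using assms(1,12) that by auto
  from local_image_in_hypersurface[OF assms(3,5,8-11) this]
  obtain e where e: "\<And>p. p \<in> M \<Longrightarrow> e p > 0 \<and> ball p (e p) \<subseteq> U \<and> H ` ball p (e p) \<subseteq> M'"
    by metis
  then show ?thesis by (intro exI[of _ "\<Union>p\<in>M. ball p (e p)"]) force
qed

end
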